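(* Let $(\widetilde{\mathbf{x}},\rho,\widetilde{B})$ be a generalized seed of geometric type with $\mathbf{ex}=[1,n]$. If $(\widetilde{\mathbf{x}},\rho,\widetilde{B})$ is coprime and acyclic, then its lower bound and upper bound coincide: $$\mathcal{L}(\widetilde{\mathbf{x}},\rho,\widetilde{B})=\mathcal{U}(\widetilde{\mathbf{x}},\rho,\widetilde{B}).$$
   Context: Notation: $[i,j]=\{i,i+1,\ldots,j\}$; $[a]_+=a$ if $a\ge 0$ and $[a]_+=0$ otherwise. Let $m\ge n\ge 1$ be integers and let $\mathbf{ex}=[1,n]$. Generalized seed (of geometric type): a triple $(\widetilde{\mathbf{x}},\rho,\widetilde{B})$ with the following data. (1) The extended cluster $\widetilde{\mathbf{x}}=\{x_1,\ldots,x_m\}$ is a set of $m$ algebraically independent elements freely generating the field $\mathbb{Q}(x_1,\ldots,x_m)$; $\mathbf{x}=\{x_1,\ldots,x_n\}$ is the cluster, its elements are the cluster variables, and $x_{n+1},\ldots,x_m$ are the frozen variables. $\mathbb{P}$ is the multiplicative free abelian group generated by the frozen variables, and $\mathbb{ZP}$ is its integer group ring (the Laurent polynomial ring over $\mathbb{Z}$ in the frozen variables). (2) $\widetilde{B}=(b_{ij})$ is an $m\times n$ integer matrix whose principal part $B$ (rows $1,\ldots,n$) is skew-symmetrizable, i.e. $DB$ is skew-symmetric for some diagonal matrix $D$ with positive integer diagonal entries. For each $s\in[1,n]$ there is a given positive integer $d_s$ dividing $b_{is}$ for all $i\in[1,m]$, and $\beta_{is}:=b_{is}/d_s$. (3)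 $\rho=\{\rho_i\mid i\in[1,n]\}$, where the $i$th string $\rho_i=\{\rho_{i,0},\ldots,\rho_{i,d_i}\}$ satisfies $\rho_{i,0}=\rho_{i,d_i}=1$ and, for $1\le j\le d_i-1$, $\rho_{i,j}$ is a monomial in $\mathbb{Z}[x_{n+1},\ldots,x_m]$ (an integer coefficient is allowed). For $i\in[1,n]$ put $P_i:=\sum_{r=0}^{d_i}\rho_{i,r}\prod_{j=1}^m x_j^{r[\beta_{ji}]_+ +(d_i-r)[-\beta_{ji}]_+}$ and $x'_i:=x_i^{-1}P_i$. All rings are subrings of $\mathbb{Q}(x_1,\ldots,x_m)$. Acyclic: the directed graph with vertex set $[1,n]$ and a directed edge $(i,j)$ if and only if $b_{ij}>0$ contains no oriented cycle. Coprime: $P_i$ and $P_j$ are coprime (have no common non-unit factor in $\mathbb{ZP}[x_1,\ldots,x_n]$) for any two different $i,j\in[1,n]$. Upper bound: $$\mathcal{U}(\widetilde{\mathbf{x}},\rho,\widetilde{B}):=\mathbb{ZP}[x_1^{\pm1},\ldots,x_n^{\pm1}]\cap\bigcap_{k=1}^n\mathbb{ZP}[x_1^{\pm1},\ldots,x_{k-1}^{\pm1},(x'_k)^{\pm1},x_{k+1}^{\pm1},\ldots,x_n^{\pm1}].$$ Lower bound: $\mathcal{L}(\widetilde{\mathbf{x}},\rho,\widetilde{B}):=\mathbb{ZP}[x_1,x'_1,\ldots,x_n,x'_n]$.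
   Formalization: The formal theorem additionally assumes x'_k ≠ 0 for all k in [1,n]; otherwise (e.g. m=n=1, b_11=0, d_1=2, ρ_{1,1}=-2, giving P_1=0) the inverse (x'_k)^{-1} in the upper bound is undefined. *)

theory Defs
  imports Complex_Main "HOL-Library.Poly_Mapping"
begin

inductive_set subring_gen :: "'a::comm_ring_1 set \<Rightarrow> 'a set" for S where
  one: "1 \<in> subring_gen S"
| base: "a \<in> S \<Longrightarrow> a \<in> subring_gen S"
| diff: "\<lbrakk>a \<in> subring_gen S; b \<in> subring_gen S\<rbrakk> \<Longrightarrow> a - b \<in> subring_gen S"
| mult: "\<lbrakk>a \<in> subring_gen S; b \<in> subring_gen S\<rbrakk> \<Longrightarrow> a * b \<in> subring_gen S"

inductive_set subfield_gen :: "'a::field set \<Rightarrow> 'a set" for S where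
  one: "1 \<in> subfield_gen S"
| base: "a \<in> S \<Longrightarrow> a \<in> subfield_gen S"
| diff: "\<lbrakk>a \<in> subfield_gen S; b \<in> subfield_gen S\<rbrakk> \<Longrightarrow> a - b \<in> subfield_gen S"
| mult: "\<lbrakk>a \<in> subfield_gen S; b \<in> subfield_gen S\<rbrakk> \<Longrightarrow> a * b \<in> subfield_gen S"
| inverse: "a \<in> subfield_gen S \<Longrightarrow> inverse a \<in> subfield_gen S"

text \<open>A polynomial with rational coefficients in variables indexed by \<open>nat\<close> is a finitely
  supported map from exponent vectors to coefficients.\<close>

definition poly_eval :: "(nat \<Rightarrow> 'a::field_char_0) \<Rightarrow> ((nat \<Rightarrow>\<^sub>0 nat) \<Rightarrow>\<^sub>0 rat) \<Rightarrow> 'a" where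
  "poly_eval x p =
     (\<Sum>e\<in>Poly_Mapping.keys p. of_rat (Poly_Mapping.lookup p e) *
        (\<Prod>i\<in>Poly_Mapping.keys e. x i ^ Poly_Mapping.lookup e i))"

definition algebraically_independent :: "nat set \<Rightarrow> (nat \<Rightarrow> 'a::field_char_0) \<Rightarrow> bool" where
  "algebraically_independent I x \<longleftrightarrow>
     (\<forall>p. (\<forall>e\<in>Poly_Mapping.keys p. Poly_Mapping.keys e \<subseteq> I) \<longrightarrow> poly_eval x p = 0 \<longrightarrow> p = 0)"

definition coprime_in :: "'a::comm_ring_1 set \<Rightarrow> 'a \<Rightarrow> 'a \<Rightarrow> bool" where
  "coprime_in R p q \<longleftrightarrow>
     (\<forall>f\<in>R. (\<exists>g\<in>R. p = f * g) \<longrightarrow> (\<exists>h\<in>R. q = f * h) \<longrightarrow> (\<exists>u\<in>R. f * u = 1))"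

text \<open>The ambient field \<open>\<rat>(x\<^sub>1, \<dots>, x\<^sub>m)\<close> is the type \<open>'a\<close> itself.
  Families and matrices are functions on \<open>nat\<close>, indexed from 1;
  values outside the index ranges are irrelevant.\<close>

locale generalized_seed =
  fixes m n :: nat
    and x :: "nat \<Rightarrow> 'a::field_char_0"
    and \<rho> :: "nat \<Rightarrow> nat \<Rightarrow> 'a"
    and d :: "nat \<Rightarrow> nat"
    and b :: "nat \<Rightarrow> nat \<Rightarrow> int"
  assumes n_pos: "1 \<le> n" and n_le_m: "n \<le> m"
    and independent: "algebraically_independent {1..m} x"
    and generates: "subfield_gen (x ` {1..m}) = UNIV"
    and skew_symmetrizable:
      "\<exists>D :: nat \<Rightarrow> int. (\<forall>i\<in>{1..n}. D i > 0) \<and>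
         (\<forall>i\<in>{1..n}. \<forall>j\<in>{1..n}. D i * b i j = - (D j * b j i))"
    and d_pos: "\<And>s. s \<in> {1..n} \<Longrightarrow> d s > 0"
    and d_dvd: "\<And>i s. \<lbrakk>i \<in> {1..m}; s \<in> {1..n}\<rbrakk> \<Longrightarrow> int (d s) dvd b i s"
    and rho_first: "\<And>i. i \<in> {1..n} \<Longrightarrow> \<rho> i 0 = 1"
    and rho_last: "\<And>i. i \<in> {1..n} \<Longrightarrow> \<rho> i (d i) = 1"
    and rho_monomial: "\<And>i j. \<lbrakk>i \<in> {1..n}; j \<in> {1..d i - 1}\<rbrakk> \<Longrightarrow>
      \<exists>(c::int) (e :: nat \<Rightarrow> nat). \<rho> i j = of_int c * (\<Prod>k\<in>{n+1..m}. x k ^ e k)"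

definition coeff_group :: "nat \<Rightarrow> nat \<Rightarrow> (nat \<Rightarrow> 'a::field) \<Rightarrow> 'a set" where
  "coeff_group m n x = {\<Prod>k\<in>{n+1..m}. x k powi a k | a. True}"

definition ZP :: "nat \<Rightarrow> nat \<Rightarrow> (nat \<Rightarrow> 'a::field) \<Rightarrow> 'a set" where
  "ZP m n x = subring_gen (coeff_group m n x)"

definition ZP_adjoin :: "nat \<Rightarrow> nat \<Rightarrow> (nat \<Rightarrow> 'a::field) \<Rightarrow> 'a set \<Rightarrow> 'a set" where
  "ZP_adjoin m n x S = subring_gen (ZP m n x \<union> S)"

definition \<beta> :: "(nat \<Rightarrow> nat) \<Rightarrow> (nat \<Rightarrow> nat \<Rightarrow> int) \<Rightarrow> nat \<Rightarrow> nat \<Rightarrow> int" where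
  "\<beta> d b i s = b i s div int (d s)"

text \<open>The function \<open>nat\<close> sends negative integers to 0, so \<open>nat a\<close> is \<open>[a]\<^sub>+\<close>.\<close>

definition exchange_poly ::
  "nat \<Rightarrow> (nat \<Rightarrow> 'a::field) \<Rightarrow> (nat \<Rightarrow> nat \<Rightarrow> 'a) \<Rightarrow> (nat \<Rightarrow> nat) \<Rightarrow> (nat \<Rightarrow> nat \<Rightarrow> int) \<Rightarrow> nat \<Rightarrow> 'a" where
  "exchange_poly m x \<rho> d b i =
     (\<Sum>r\<in>{0..d i}. \<rho> i r *
        (\<Prod>j\<in>{1..m}. x j ^ (r * nat (\<beta> d b j i) + (d i - r) * nat (- \<beta> d b j i))))"

definition exchanged_var ::
  "nat \<Rightarrow> (nat \<Rightarrow> 'a::field) \<Rightarrow> (nat \<Rightarrow> nat \<Rightarrow> 'a) \<Rightarrow> (nat \<Rightarrow> nat) \<Rightarrow> (nat \<Rightarrow> nat \<Rightarrow> int) \<Rightarrow> nat \<Rightarrow> 'a" where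
  "exchanged_var m x \<rho> d b i = inverse (x i) * exchange_poly m x \<rho> d b i"

definition acyclic_seed :: "nat \<Rightarrow> (nat \<Rightarrow> nat \<Rightarrow> int) \<Rightarrow> bool" where
  "acyclic_seed n b \<longleftrightarrow> acyclic {(i, j). i \<in> {1..n} \<and> j \<in> {1..n} \<and> b i j > 0}"

definition coprime_seed ::
  "nat \<Rightarrow> nat \<Rightarrow> (nat \<Rightarrow> 'a::field) \<Rightarrow> (nat \<Rightarrow> nat \<Rightarrow> 'a) \<Rightarrow> (nat \<Rightarrow> nat) \<Rightarrow> (nat \<Rightarrow> nat \<Rightarrow> int) \<Rightarrow> bool" where
  "coprime_seed m n x \<rho> d b \<longleftrightarrow>
     (\<forall>i\<in>{1..n}. \<forall>j\<in>{1..n}. i \<noteq> j \<longrightarrow>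
        coprime_in (ZP_adjoin m n x (x ` {1..n}))
          (exchange_poly m x \<rho> d b i) (exchange_poly m x \<rho> d b j))"

definition lower_bound ::
  "nat \<Rightarrow> nat \<Rightarrow> (nat \<Rightarrow> 'a::field) \<Rightarrow> (nat \<Rightarrow> nat \<Rightarrow> 'a) \<Rightarrow> (nat \<Rightarrow> nat) \<Rightarrow> (nat \<Rightarrow> nat \<Rightarrow> int) \<Rightarrow> 'a set" where
  "lower_bound m n x \<rho> d b =
     ZP_adjoin m n x (\<Union>i\<in>{1..n}. {x i, exchanged_var m x \<rho> d b i})"

text \<open>Since \<open>inverse 0 = 0\<close>, this is the upper bound only if every exchanged variable is
  nonzero; otherwise its inverse, and with it the upper bound, is undefined. An exchanged
  variable can vanish only when the corresponding column of the matrix is zero, as for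
  \<open>m = n = 1\<close>, \<open>d 1 = 2\<close>, \<open>\<rho> 1 1 = -2\<close>.\<close>

definition upper_bound ::
  "nat \<Rightarrow> nat \<Rightarrow> (nat \<Rightarrow> 'a::field) \<Rightarrow> (nat \<Rightarrow> nat \<Rightarrow> 'a) \<Rightarrow> (nat \<Rightarrow> nat) \<Rightarrow> (nat \<Rightarrow> nat \<Rightarrow> int) \<Rightarrow> 'a set" where
  "upper_bound m n x \<rho> d b =
     ZP_adjoin m n x (\<Union>i\<in>{1..n}. {x i, inverse (x i)}) \<inter>
     (\<Inter>k\<in>{1..n}. ZP_adjoin m n x
        ({exchanged_var m x \<rho> d b k, inverse (exchanged_var m x \<rho> d b k)} \<union>
         (\<Union>i\<in>{1..n} - {k}. {x i, inverse (x i)})))"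

end

theory Submission
  imports Defs "HOL-Computational_Algebra.Polynomial"
begin

text \<open>
  Every generator of the lower bound lies in every ring of the upper bound, because the exchange
  polynomial \<open>P\<^sub>k\<close> does not involve \<open>x\<^sub>k\<close> (\<open>lower_bound_subset_upper_bound\<close>). The content of the
  theorem is the other inclusion.

  An element of the upper bound is a Laurent polynomial \<open>y\<close> in \<open>x\<^sub>1, \<dots>, x\<^sub>m\<close>. Membership in
  the \<open>k\<close>-th ring says that for all \<open>a > 0\<close> the part of \<open>y\<close> of degree \<open>- a\<close> in \<open>x\<^sub>k\<close>
  is divisible by \<open>P\<^sub>k ^ a\<close> (\<open>exchange_ring_div_cond\<close>). From these divisibilities alone, \<open>y\<close> is
  rewritten as a polynomial in the \<open>x\<^sub>i\<close> and \<open>x'\<^sub>i = P\<^sub>i / x\<^sub>i\<close>, by eliminating one variable after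
  the other in an order that follows the arrows of the acyclic graph. Let \<open>t\<close> be a source among the
  remaining vertices.

  If \<open>y\<close> has a term of negative degree in \<open>x\<^sub>t\<close>, its part of lowest degree \<open>- k\<close> is
  \<open>x'\<^sub>t ^ k * e\<close>, where \<open>e\<close> does not involve \<open>x\<^sub>t\<close>. This part satisfies the divisibility
  conditions for the polynomials \<open>P\<^sub>j\<close> with \<open>x\<^sub>t = 0\<close> substituted, and so does \<open>e\<close>: if \<open>t\<close> and
  \<open>j\<close> are joined by an edge, \<open>P\<^sub>j\<close> becomes a monomial and the condition is void; if they are not,
  \<open>P\<^sub>t\<close> does not involve \<open>x\<^sub>j\<close> and the factor \<open>P\<^sub>t ^ k\<close> can be cancelled by coprimality.
  By induction, \<open>e\<close> is a polynomial in the remaining variables and their specialised exchanged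
  variables. Lifting this expression to one in which \<open>x\<^sub>t\<close> is not set to 0, and subtracting
  \<open>x'\<^sub>t ^ k\<close> times the lift from \<open>y\<close>, raises the lowest degree in \<open>x\<^sub>t\<close>. When no
  negative powers of \<open>x\<^sub>t\<close> are left, \<open>x\<^sub>t\<close> is treated as a polynomial parameter and the induction
  applies once more. The induction therefore runs over three disjoint sets: variables set to 0,
  variables that occur polynomially, and variables still to be eliminated
  (\<open>upper_alg_subset_lower_alg\<close>).

  Coprimality is given as the absence of common nonunit factors. That this permits cancellation
  rests on greatest common divisors in polynomial rings in several variables, which are obtained by
  adjoining one variable at a time (\<open>gcd_subring_polys_over\<close>, \<open>gcd_subring_poly_ring\<close>).
\<close>

section \<open>Greatest common divisors in subrings and Gauss's lemma\<close>

definition is_subring :: "'b::idom set \<Rightarrow> bool" where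
  "is_subring S \<longleftrightarrow> 1 \<in> S \<and> (\<forall>a\<in>S. \<forall>b\<in>S. a - b \<in> S \<and> a * b \<in> S)"

definition dvd_in :: "'b::idom set \<Rightarrow> 'b \<Rightarrow> 'b \<Rightarrow> bool" where
  "dvd_in S a b \<longleftrightarrow> (\<exists>c\<in>S. b = a * c)"

text \<open>In other words, \<open>b\<close> is a nonzerodivisor modulo \<open>a\<close>. For \<open>a \<noteq> 0\<close> this implies that \<open>a\<close> and
  \<open>b\<close> have no common nonunit factor in \<open>S\<close>; the converse needs greatest common divisors.\<close>
definition cancels_in :: "'b::idom set \<Rightarrow> 'b \<Rightarrow> 'b \<Rightarrow> bool" where
  "cancels_in S a b \<longleftrightarrow> (\<forall>g\<in>S. dvd_in S a (b * g) \<longrightarrow> dvd_in S a g)"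

text \<open>A subring in which any two elements have a greatest common divisor \<open>d\<close>. The two
  conditions on the cofactors differ if one cofactor is 0: together they force the other one to be
  a unit.\<close>
definition gcd_subring :: "'b::idom set \<Rightarrow> bool" where
  "gcd_subring S \<longleftrightarrow> is_subring S \<and>
     (\<forall>a\<in>S. \<forall>b\<in>S. \<exists>d\<in>S. \<exists>a'\<in>S. \<exists>b'\<in>S.
        a = d * a' \<and> b = d * b' \<and> cancels_in S a' b' \<and> cancels_in S b' a')"

definition polys_over :: "'b::idom set \<Rightarrow> 'b poly set" where
  "polys_over S = {f. \<forall>i. coeff f i \<in> S}"

text \<open>For polynomials over a ring with greatest common divisors this says that the coefficients have no
  common factor. The form chosen has the conclusion of Gauss's lemma built in: factors of
  primitive polynomials are primitive for trivial reasons, and all the work is in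
  \<open>primitive_over_pCons\<close>.\<close>
definition primitive_over :: "'b::idom set \<Rightarrow> 'b poly \<Rightarrow> bool" where
  "primitive_over S f \<longleftrightarrow> (\<forall>s\<in>S - {0}. cancels_in (polys_over S) [:s:] f)"

context
  fixes S :: "'b::idom set"
  assumes S: "is_subring S"
begin

lemma subring_one: "1 \<in> S"
  using S by (auto simp: is_subring_def)

lemma subring_diff: "a \<in> S \<Longrightarrow> b \<in> S \<Longrightarrow> a - b \<in> S"
  using S by (auto simp: is_subring_def)

lemma subring_mult: "a \<in> S \<Longrightarrow> b \<in> S \<Longrightarrow> a * b \<in> S"
  using S by (auto simp: is_subring_def)

lemma subring_zero: "0 \<in> S"
  using subring_diff[OF subring_one subring_one] by simp

lemma subring_minus: "a \<in> S \<Longrightarrow> - a \<in> S"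
  using subring_diff[OF subring_zero, of a] by simp

lemma subring_add: "a \<in> S \<Longrightarrow> b \<in> S \<Longrightarrow> a + b \<in> S"
  using subring_diff[OF _ subring_minus, of a b] by simp

lemma subring_sum: "(\<And>i. i \<in> I \<Longrightarrow> g i \<in> S) \<Longrightarrow> sum g I \<in> S"
  by (induction I rule: infinite_finite_induct) (auto intro: subring_zero subring_add)

lemma subring_prod: "(\<And>i. i \<in> I \<Longrightarrow> g i \<in> S) \<Longrightarrow> prod g I \<in> S"
  by (induction I rule: infinite_finite_induct) (auto intro: subring_one subring_mult)

lemma subring_power: "a \<in> S \<Longrightarrow> a ^ k \<in> S"
  by (induction k) (auto intro: subring_one subring_mult)

lemma subring_of_int: "of_int k \<in> S"
proof -
  have nat: "of_nat j \<in> S" for j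
    by (induction j) (auto intro: subring_zero subring_one subring_add)
  show ?thesis
  proof (cases "k \<ge> 0")
    case True
    then show ?thesis using nat[of "nat k"] by simp
  next
    case False
    then have "of_int k = - (of_nat (nat (- k)) :: 'b)" by simp
    then show ?thesis using subring_minus[OF nat] by metis
  qed
qed

lemma polys_over_subring: "is_subring (polys_over S)"
  unfolding is_subring_def polys_over_def
  by (auto simp: coeff_mult coeff_1 intro: subring_sum subring_mult subring_diff subring_one
      subring_zero)

lemma polys_over_pCons [simp]: "pCons a f \<in> polys_over S \<longleftrightarrow> a \<in> S \<and> f \<in> polys_over S"
  by (auto simp: polys_over_def coeff_pCons split: nat.splits)

lemma polys_over_zero [simp]: "0 \<in> polys_over S"
  by (simp add: polys_over_def subring_zero)

lemma polys_over_smult: "c \<in> S \<Longrightarrow> f \<in> polys_over S \<Longrightarrow> smult c f \<in> polys_over S"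
  by (simp add: polys_over_def subring_mult)

lemma polys_over_monom: "c \<in> S \<Longrightarrow> monom c k \<in> polys_over S"
  by (simp add: polys_over_def coeff_monom subring_zero)

lemma dvd_in_refl: "dvd_in S a a"
  unfolding dvd_in_def using subring_one by force

lemma dvd_in_mult: "dvd_in S a b \<Longrightarrow> c \<in> S \<Longrightarrow> dvd_in S a (b * c)"
  unfolding dvd_in_def by (metis mult.assoc subring_mult)

lemma dvd_in_diff: "dvd_in S a b \<Longrightarrow> dvd_in S a c \<Longrightarrow> dvd_in S a (b - c)"
  unfolding dvd_in_def by (metis right_diff_distrib subring_diff)

lemma dvd_in_add: "dvd_in S a b \<Longrightarrow> dvd_in S a c \<Longrightarrow> dvd_in S a (b + c)"
  unfolding dvd_in_def by (metis distrib_left subring_add)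

lemma dvd_in_cancel:
  assumes "k \<noteq> 0" "dvd_in S (k * a) (k * b)"
  shows "dvd_in S a b"
  using assms unfolding dvd_in_def by (metis mult.assoc mult_left_cancel)

text \<open>If \<open>a * u = s * p\<close> and \<open>c * u = s * q\<close>, then \<open>c * p = a * q\<close>, so \<open>a\<close> divides \<open>p\<close> and
  the quotient \<open>p / a\<close> is \<open>u / s\<close>. For \<open>a = 0\<close> the second hypothesis makes \<open>c\<close> a unit.\<close>
lemma dvd_in_cofactors:
  assumes ac: "cancels_in S a c" "cancels_in S c a"
    and mem: "a \<in> S" "c \<in> S" "s \<in> S" "u \<in> S"
    and s: "dvd_in S s (a * u)" "dvd_in S s (c * u)"
  shows "dvd_in S s u"
proof (cases "a = 0")
  case True
  then have "dvd_in S c (a * 1)" using subring_zero by (auto simp: dvd_in_def)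
  then obtain w where w: "w \<in> S" "1 = c * w"
    using ac(2) subring_one unfolding cancels_in_def dvd_in_def by metis
  have "dvd_in S s (c * u * w)" by (rule dvd_in_mult[OF s(2) w(1)])
  moreover have "c * u * w = u" using w by (simp add: mult_ac)
  ultimately show ?thesis by simp
next
  case False
  obtain p q where p: "p \<in> S" "a * u = s * p" and q: "q \<in> S" "c * u = s * q"
    using s by (auto simp: dvd_in_def)
  show ?thesis
  proof (cases "s = 0")
    case True
    then show ?thesis using p False subring_zero by (auto simp: dvd_in_def)
  next
    case s0: False
    have "s * (a * q) = s * (c * p)" using p(2) q(2) by (metis mult.left_commute)
    then have "c * p = a * q" using s0 by simp
    then have "dvd_in S a p" using ac(1) p(1) q(1) unfolding cancels_in_def dvd_in_def by blast
    then obtain w where "w \<in> S" "p = a * w" by (auto simp: dvd_in_def)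
    then have "a * u = a * (s * w)" using p by (simp add: mult_ac)
    then have "u = s * w" using False by simp
    then show ?thesis using \<open>w \<in> S\<close> by (auto simp: dvd_in_def)
  qed
qed

lemma const_dvd_in_polys_iff:
  "dvd_in (polys_over S) [:s:] f \<longleftrightarrow> (\<forall>i. dvd_in S s (coeff f i))"
proof
  assume "dvd_in (polys_over S) [:s:] f"
  then show "\<forall>i. dvd_in S s (coeff f i)"
    by (auto simp: dvd_in_def polys_over_def)
next
  assume "\<forall>i. dvd_in S s (coeff f i)"
  then show "dvd_in (polys_over S) [:s:] f"
  proof (induction f)
    case 0
    have "[:s:] * 0 = 0" by simp
    then show ?case unfolding dvd_in_def using polys_over_zero by (metis)
  next
    case (pCons a f)
    have "\<forall>i. dvd_in S s (coeff f i)" using pCons.prems by (metis coeff_pCons_Suc)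
    then obtain g where g: "g \<in> polys_over S" "f = [:s:] * g"
      using pCons.IH by (auto simp: dvd_in_def)
    obtain c where c: "c \<in> S" "a = s * c"
      using pCons.prems by (metis coeff_pCons_0 dvd_in_def)
    have "pCons a f = [:s:] * pCons c g" using g c by simp
    then show ?case using g c unfolding dvd_in_def by (metis polys_over_pCons)
  qed
qed

end

lemma primitive_over_factor:
  assumes S: "is_subring S"
    and "primitive_over S (f * g)" "g \<in> polys_over S" "f \<in> polys_over S"
  shows "primitive_over S f"
proof -
  show ?thesis
    unfolding primitive_over_def cancels_in_def
  proof safe
    fix s h assume s: "s \<in> S" "s \<noteq> 0" and h: "h \<in> polys_over S"
      and dvd: "dvd_in (polys_over S) [:s:] (f * h)"
    have "f * h * g = f * g * h" by (simp add: mult_ac)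
    then have "dvd_in (polys_over S) [:s:] (f * g * h)"
      using dvd_in_mult[OF polys_over_subring[OF S] dvd assms(3)] by metis
    then show "dvd_in (polys_over S) [:s:] h"
      using assms(2) s h unfolding primitive_over_def cancels_in_def by blast
  qed
qed

text \<open>From \<open>s * h = f * k\<close>, primitivity of \<open>f\<close> moves the constant \<open>s\<close> into \<open>k\<close>, and \<open>s\<close> cancels.\<close>
lemma primitive_over_cancels_const:
  assumes S: "is_subring S"
    and f: "primitive_over S f" "f \<in> polys_over S" and s: "s \<in> S" "s \<noteq> 0"
  shows "cancels_in (polys_over S) f [:s:]"
  unfolding cancels_in_def
proof safe
  fix h assume h: "h \<in> polys_over S" and "dvd_in (polys_over S) f ([:s:] * h)"
  then obtain k where k: "k \<in> polys_over S" "[:s:] * h = f * k" by (auto simp: dvd_in_def)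
  then have "dvd_in (polys_over S) [:s:] (f * k)" using h unfolding dvd_in_def by metis
  then obtain k' where k': "k' \<in> polys_over S" "k = [:s:] * k'"
    using f(1) s k unfolding primitive_over_def cancels_in_def dvd_in_def by blast
  have "[:s:] * h = [:s:] * (f * k')" using k(2) k'(2) by (metis mult.left_commute)
  then have "h = f * k'" using s(2) by (metis mult_left_cancel pCons_eq_0_iff)
  then show "dvd_in (polys_over S) f h" using k' by (auto simp: dvd_in_def)
qed

context
  fixes S :: "'b::idom set"
  assumes gcd: "gcd_subring S"
begin

lemma gcd_is_subring: "is_subring S"
  using gcd by (simp add: gcd_subring_def)

private lemmas S = gcd_is_subring
private lemmas PS = polys_over_subring[OF S]

lemma gcd_subringE:
  assumes "a \<in> S" "b \<in> S"
  obtains d a' b' where "d \<in> S" "a' \<in> S" "b' \<in> S" "a = d * a'" "b = d * b'"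
    "cancels_in S a' b'" "cancels_in S b' a'"
  using gcd assms unfolding gcd_subring_def by metis

text \<open>Gauss's lemma, for polynomials built up from their constant coefficient. Suppose the constant
  \<open>s\<close> divides \<open>f * g\<close>, where \<open>f = a + X * c * h\<close> and \<open>g = b + X * g\<^sub>1\<close>. First the common
  divisor \<open>t\<close> of \<open>s\<close> and \<open>b\<close> is removed: it divides \<open>f * g\<^sub>1\<close>, hence \<open>g\<^sub>1\<close> by
  induction on \<open>g\<close>, hence \<open>g\<close>. The remaining part \<open>s'\<close> of \<open>s\<close> is coprime to the
  constant coefficient of \<open>G = g / t\<close>, so it divides \<open>a\<close>. Then it also divides \<open>c * h * G\<close>,
  hence \<open>c * G\<close>. As \<open>a\<close> and \<open>c\<close> are coprime, it divides \<open>G\<close>.\<close>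
lemma primitive_over_pCons:
  assumes h: "primitive_over S h" "h \<in> polys_over S" and ac: "a \<in> S" "c \<in> S"
    and cop: "cancels_in S a c" "cancels_in S c a"
  shows "primitive_over S (pCons a (smult c h))"
proof -
  define f where "f = pCons a (smult c h)"
  have f: "f \<in> polys_over S"
    using h ac S by (simp add: f_def polys_over_smult)
  have "dvd_in (polys_over S) [:s:] g"
    if "g \<in> polys_over S" "s \<in> S" "s \<noteq> 0" "dvd_in (polys_over S) [:s:] (f * g)" for s g
    using that
  proof (induction g arbitrary: s)
    case 0
    then show ?case using S by (auto simp: const_dvd_in_polys_iff dvd_in_def intro: subring_zero)
  next
    case (pCons b g)
    have b: "b \<in> S" and g: "g \<in> polys_over S" using pCons.prems S by auto
    obtain t s' b' where t: "t \<in> S" "s' \<in> S" "b' \<in> S" "s = t * s'" "b = t * b'"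
      and s'b': "cancels_in S s' b'"
      using gcd_subringE[OF \<open>s \<in> S\<close> b] by metis
    have nz: "t \<noteq> 0" "s' \<noteq> 0" using t \<open>s \<noteq> 0\<close> by auto
    have ts: "[:s:] = [:t:] * [:s':]" using t by simp
    have "dvd_in (polys_over S) [:t:] (f * pCons b g)"
      using pCons.prems(4) ts t S unfolding dvd_in_def
      by (metis mult.assoc polys_over_pCons polys_over_zero subring_mult[OF PS])
    moreover have "dvd_in (polys_over S) [:t:] (f * [:b:])"
    proof -
      have "f * [:b:] = [:t:] * (f * [:b':])" using t by (simp add: mult_ac)
      then show ?thesis using f t S unfolding dvd_in_def
        by (metis polys_over_pCons polys_over_zero subring_mult[OF PS])
    qed
    ultimately have "dvd_in (polys_over S) [:t:] (f * pCons b g - f * [:b:])"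
      by (rule dvd_in_diff[OF PS])
    moreover have "f * pCons b g - f * [:b:] = pCons 0 (f * g)"
      by (simp)
    ultimately have "dvd_in (polys_over S) [:t:] (pCons 0 (f * g))" by simp
    then have "dvd_in (polys_over S) [:t:] (f * g)"
      unfolding const_dvd_in_polys_iff[OF S] by (metis coeff_pCons_Suc)
    then have "dvd_in (polys_over S) [:t:] g"
      using pCons.IH g t nz by blast
    then obtain g' where g': "g' \<in> polys_over S" "g = [:t:] * g'" by (auto simp: dvd_in_def)
    define G where "G = pCons b' g'"
    have G: "G \<in> polys_over S" "pCons b g = [:t:] * G"
      using g' t S by (auto simp: G_def)
    have "dvd_in (polys_over S) ([:t:] * [:s':]) ([:t:] * (f * G))"
      using pCons.prems(4) ts G by (metis mult.left_commute)
    then have s'f: "dvd_in (polys_over S) [:s':] (f * G)"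
      using dvd_in_cancel[OF PS] nz by (metis pCons_eq_0_iff)
    have "coeff (f * G) 0 = b' * a" by (simp add: f_def G_def)
    then have "dvd_in S s' (b' * a)" using s'f const_dvd_in_polys_iff[OF S] by metis
    then have s'a: "dvd_in S s' a" using s'b' ac by (auto simp: cancels_in_def)
    then have 1: "dvd_in S s' (a * coeff G i)" for i
      using G dvd_in_mult[OF S] by (auto simp: polys_over_def)
    have "dvd_in (polys_over S) [:s':] (smult a G)"
      using 1 by (simp add: const_dvd_in_polys_iff[OF S])
    then have "dvd_in (polys_over S) [:s':] (f * G - smult a G)"
      using s'f dvd_in_diff[OF PS] by blast
    moreover have "f * G - smult a G = pCons 0 (h * smult c G)"
      by (simp add: f_def)
    ultimately have "dvd_in (polys_over S) [:s':] (h * smult c G)"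
      unfolding const_dvd_in_polys_iff[OF S] by (metis coeff_pCons_Suc)
    then have "dvd_in (polys_over S) [:s':] (smult c G)"
      using h t nz G ac S polys_over_smult[OF S] by (auto simp: primitive_over_def cancels_in_def)
    then have 2: "dvd_in S s' (c * coeff G i)" for i
      by (simp add: const_dvd_in_polys_iff[OF S])
    have "dvd_in S s' (coeff G i)" for i
      using dvd_in_cofactors[OF S cop ac t(2) _ 1 2] G by (auto simp: polys_over_def)
    then obtain K where "K \<in> polys_over S" "G = [:s':] * K"
      using const_dvd_in_polys_iff[OF S] by (metis dvd_in_def)
    then have "pCons b g = [:s:] * K" using G ts by (metis mult.assoc)
    then show ?case using \<open>K \<in> polys_over S\<close> by (auto simp: dvd_in_def)
  qed
  then show ?thesis
    unfolding primitive_over_def cancels_in_def f_def by blast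
qed

lemma content_exists:
  assumes "f \<in> polys_over S"
  obtains c f0 where "c \<in> S" "f0 \<in> polys_over S" "f = smult c f0" "primitive_over S f0"
proof -
  have "\<exists>c f0. c \<in> S \<and> f0 \<in> polys_over S \<and> f = smult c f0 \<and> primitive_over S f0"
    using assms
  proof (induction f)
    case 0
    have "primitive_over S 1" by (simp add: primitive_over_def cancels_in_def)
    then show ?case using subring_one[OF PS] subring_zero[OF S]
      by (metis smult_0_left)
  next
    case (pCons a f)
    then obtain c f0 where f0: "c \<in> S" "f0 \<in> polys_over S" "f = smult c f0" "primitive_over S f0"
      using S by auto
    have "a \<in> S" using pCons.prems S by simp
    then obtain d a' c' where d: "d \<in> S" "a' \<in> S" "c' \<in> S" "a = d * a'" "c = d * c'"
      "cancels_in S a' c'" "cancels_in S c' a'"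
      using gcd_subringE f0(1) by metis
    have "primitive_over S (pCons a' (smult c' f0))"
      using primitive_over_pCons f0 d by blast
    moreover have "pCons a f = smult d (pCons a' (smult c' f0))"
      using f0 d by simp
    moreover have "pCons a' (smult c' f0) \<in> polys_over S"
      using f0 d S by (simp add: polys_over_smult)
    ultimately show ?case using d by blast
  qed
  then show thesis using that by blast
qed

text \<open>Let \<open>r\<close> be a nonzero element of least degree in the ideal of \<open>f\<close> and \<open>g\<close>. Pseudodivision by
  \<open>r\<close> leaves no remainder, so up to a constant factor \<open>r\<close> divides every element of the ideal, and
  its primitive part \<open>r0\<close> divides them outright. Writing \<open>r\<close> as a combination of \<open>f\<close> and \<open>g\<close>
  gives a Bezout identity \<open>c = a * f' + b * g'\<close> with a nonzero constant \<open>c\<close>, which is harmless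
  because the cofactors \<open>f'\<close> and \<open>g'\<close> are primitive.\<close>
lemma gcd_primitive:
  assumes f: "f \<in> polys_over S" "primitive_over S f" "f \<noteq> 0"
    and g: "g \<in> polys_over S" "primitive_over S g" "g \<noteq> 0"
  obtains r f' g' where "r \<in> polys_over S" "f' \<in> polys_over S" "g' \<in> polys_over S"
    "f = r * f'" "g = r * g'"
    "cancels_in (polys_over S) f' g'" "cancels_in (polys_over S) g' f'"
proof -
  let ?P = "polys_over S"
  define J where "J = {a * f + b * g | a b. a \<in> ?P \<and> b \<in> ?P}"
  have JP: "h \<in> ?P" if "h \<in> J" for h
    using that f g by (auto simp: J_def intro!: subring_add[OF PS] subring_mult[OF PS])
  have Jdiff: "h - k \<in> J" if hk: "h \<in> J" "k \<in> J" for h k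
  proof -
    obtain a b a' b' where "h = a * f + b * g" "k = a' * f + b' * g"
      and P: "a \<in> ?P" "b \<in> ?P" "a' \<in> ?P" "b' \<in> ?P"
      using hk by (auto simp: J_def)
    then have "h - k = (a - a') * f + (b - b') * g" by (simp add: algebra_simps)
    then show ?thesis unfolding J_def using P subring_diff[OF PS] by blast
  qed
  have Jmult: "k * h \<in> J" if hk: "h \<in> J" "k \<in> ?P" for h k
  proof -
    obtain a b where "h = a * f + b * g" and P: "a \<in> ?P" "b \<in> ?P"
      using hk by (auto simp: J_def)
    then have "k * h = (k * a) * f + (k * b) * g" by (simp add: algebra_simps)
    then show ?thesis unfolding J_def using P hk subring_mult[OF PS] by blast
  qed
  have "1 * f + 0 * g \<in> J" unfolding J_def
    using subring_one[OF PS] subring_zero[OF PS] by blast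
  then have fJ: "f \<in> J" by simp
  have "0 * f + 1 * g \<in> J" unfolding J_def
    using subring_one[OF PS] subring_zero[OF PS] by blast
  then have gJ: "g \<in> J" by simp
  define r where "r = arg_min degree (\<lambda>h. h \<in> J \<and> h \<noteq> 0)"
  have r: "r \<in> J" "r \<noteq> 0" and rmin: "h \<in> J \<Longrightarrow> h \<noteq> 0 \<Longrightarrow> degree r \<le> degree h" for h
    unfolding r_def using arg_min_natI[of "\<lambda>h. h \<in> J \<and> h \<noteq> 0" f degree] fJ f(3)
      arg_min_nat_le[of "\<lambda>h. h \<in> J \<and> h \<noteq> 0" _ degree] by auto
  define l where "l = lead_coeff r"
  have l: "l \<in> S" "l \<noteq> 0"
    using r JP by (auto simp: l_def polys_over_def)
  have div: "\<exists>k. dvd_in ?P r (smult (l ^ k) h)" if hJ: "h \<in> J" for h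
    using hJ
  proof (induction "degree h" arbitrary: h rule: less_induct)
    case less
    show ?case
    proof (cases "h = 0")
      case True
      then show ?thesis using subring_zero[OF PS] by (auto simp: dvd_in_def)
    next
      case False
      \<comment> \<open>one step of pseudodivision: multiply by the leading coefficient of the divisor
        and remove the leading term\<close>
      define e where "e = degree h - degree r"
      define q where "q = monom (lead_coeff h) e"
      have q: "q \<in> ?P"
        using JP[OF less.prems] by (auto simp: q_def polys_over_def coeff_monom subring_zero[OF S])
      define h' where "h' = smult l h - q * r"
      have deg: "degree h = e + degree r" using rmin[OF less.prems False] by (simp add: e_def)
      have "smult l h = [:l:] * h" by simp
      then have h'J: "h' \<in> J"
        unfolding h'_def using less.prems r q l S
        by (metis Jdiff Jmult polys_over_pCons polys_over_zero)
      have "degree h' < degree h \<or> h' = 0"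
      proof (cases "degree h = 0")
        case True
        then have "degree r = 0" "e = 0" using deg by auto
        then have "h' = 0"
          using True unfolding h'_def q_def l_def
          by (auto simp: monom_0 elim!: degree_eq_zeroE)
        then show ?thesis ..
      next
        case False
        have "degree h' \<le> degree h"
          unfolding h'_def q_def using deg degree_mult_le[of "monom (lead_coeff h) e" r]
            degree_monom_le[of "lead_coeff h" e] degree_smult_le[of l h]
          by (intro degree_diff_le) auto
        moreover have "coeff h' (degree h) = 0"
          unfolding h'_def q_def l_def using deg
          by (simp add: coeff_monom_mult)
        ultimately show ?thesis
          by (metis eq_zero_or_degree_less)
      qed
      then obtain k where "dvd_in ?P r (smult (l ^ k) h')"
      proof
        assume "degree h' < degree h"
        then show ?thesis using less.hyps h'J that by blast
      next
        assume "h' = 0"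
        then show ?thesis using that[of 0] subring_zero[OF PS] by (auto simp: dvd_in_def)
      qed
      then obtain w where w: "w \<in> ?P" "smult (l ^ k) h' = r * w" by (auto simp: dvd_in_def)
      have "smult (l ^ Suc k) h = smult (l ^ k) (h' + q * r)"
        by (simp add: h'_def mult.commute)
      also have "\<dots> = r * (w + smult (l ^ k) q)"
        using w by (simp add: algebra_simps smult_add_right)
      finally show ?thesis
        using w q l subring_add[OF PS] polys_over_smult[OF S] subring_power[OF S]
        unfolding dvd_in_def by blast
    qed
  qed
  obtain c r0 where r0: "c \<in> S" "r0 \<in> ?P" "r = smult c r0" "primitive_over S r0"
    using content_exists JP r by metis
  have c0: "c \<noteq> 0" using r r0 by auto
  have r0_dvd: "dvd_in ?P r0 h" if hJ: "h \<in> J" for h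
  proof -
    obtain k w where w: "w \<in> ?P" "smult (l ^ k) h = r * w"
      using div[OF hJ] by (auto simp: dvd_in_def)
    then have "[:l ^ k:] * h = r0 * smult c w" using r0 by simp
    then have "dvd_in ?P r0 ([:l ^ k:] * h)"
      using w r0 polys_over_smult[OF S] unfolding dvd_in_def by blast
    moreover have "cancels_in ?P r0 [:l ^ k:]"
      using primitive_over_cancels_const[OF S] r0 l subring_power[OF S] by simp
    ultimately show ?thesis using JP[OF hJ] by (auto simp: cancels_in_def)
  qed
  obtain f' g' where f': "f' \<in> ?P" "f = r0 * f'" and g': "g' \<in> ?P" "g = r0 * g'"
    using r0_dvd[OF fJ] r0_dvd[OF gJ] by (auto simp: dvd_in_def)
  obtain a b where ab: "a \<in> ?P" "b \<in> ?P" "r = a * f + b * g"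
    using r by (auto simp: J_def)
  have "r0 * [:c:] = r0 * (a * f' + b * g')"
    using ab(3) unfolding f'(2) g'(2) r0(3) by (simp add: algebra_simps)
  moreover have "r0 \<noteq> 0" using r r0 by auto
  ultimately have bez: "[:c:] = a * f' + b * g'" using mult_left_cancel by blast
  have prim: "primitive_over S f'" "primitive_over S g'"
    using primitive_over_factor[OF S, of f' r0] primitive_over_factor[OF S, of g' r0] f f' g g' r0
    by (auto simp: mult.commute)
  have canc: "cancels_in ?P u v"
    if u: "u \<in> ?P" "primitive_over S u" and v: "v \<in> ?P" and pq: "p \<in> ?P" "q \<in> ?P"
      and e: "[:c:] = p * u + q * v" for u v p q
    unfolding cancels_in_def
  proof safe
    fix h assume h: "h \<in> ?P" and "dvd_in ?P u (v * h)"
    then have "dvd_in ?P u (v * h * q)" using pq dvd_in_mult[OF PS] by blast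
    moreover have "dvd_in ?P u (u * (p * h))"
      using dvd_in_mult[OF PS dvd_in_refl[OF PS]] pq h subring_mult[OF PS] by blast
    ultimately have "dvd_in ?P u (v * h * q + u * (p * h))"
      using dvd_in_add[OF PS] by blast
    moreover have "v * h * q + u * (p * h) = [:c:] * h"
      unfolding e by (simp add: algebra_simps)
    ultimately show "dvd_in ?P u h"
      using primitive_over_cancels_const[OF S u(2,1) r0(1) c0] h by (auto simp: cancels_in_def)
  qed
  have "cancels_in ?P f' g'" by (rule canc[OF f'(1) prim(1) g'(1) ab(1,2) bez])
  moreover have "cancels_in ?P g' f'"
    by (rule canc[OF g'(1) prim(2) f'(1) ab(2,1)]) (simp add: bez)
  ultimately show thesis using that[OF r0(2) f'(1) g'(1) f'(2) g'(2)] by blast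
qed

lemma cancels_in_const_times_primitive:
  assumes f: "f \<in> polys_over S" "primitive_over S f" and g: "g \<in> polys_over S" "primitive_over S g"
    and c: "c \<in> S" "c \<noteq> 0" and e: "e \<in> S" "e \<noteq> 0"
    and ce: "cancels_in S c e" and fg: "cancels_in (polys_over S) f g"
  shows "cancels_in (polys_over S) ([:c:] * f) ([:e:] * g)"
  unfolding cancels_in_def
proof safe
  let ?P = "polys_over S"
  have cP: "[:c:] \<in> ?P" and eP: "[:e:] \<in> ?P" using c e S by auto
  fix h assume h: "h \<in> ?P" and "dvd_in ?P ([:c:] * f) ([:e:] * g * h)"
  then obtain k where k: "k \<in> ?P" "[:e:] * g * h = [:c:] * f * k" by (auto simp: dvd_in_def)
  have "g * ([:e:] * h) = [:c:] * (f * k)"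
    using k(2) by (simp only: mult_ac)
  then have "dvd_in ?P [:c:] (g * ([:e:] * h))"
    using subring_mult[OF PS f(1) k(1)] unfolding dvd_in_def by blast
  then have "dvd_in ?P [:c:] ([:e:] * h)"
    using g c subring_mult[OF PS eP h] unfolding primitive_over_def cancels_in_def by blast
  then have "dvd_in S c (e * coeff h i)" for i
    by (simp add: const_dvd_in_polys_iff[OF S])
  then have "dvd_in S c (coeff h i)" for i
    using ce h by (auto simp: cancels_in_def polys_over_def)
  then obtain h' where h': "h' \<in> ?P" "h = [:c:] * h'"
    using const_dvd_in_polys_iff[OF S] by (metis dvd_in_def)
  have "[:c:] * (g * ([:e:] * h')) = [:c:] * (f * k)"
    using k h' by (simp add: mult_ac)
  then have "g * ([:e:] * h') = f * k" using c by (metis mult_left_cancel pCons_eq_0_iff)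
  then have "dvd_in ?P f (g * ([:e:] * h'))" using k by (auto simp: dvd_in_def)
  then have "dvd_in ?P f ([:e:] * h')"
    using fg subring_mult[OF PS eP h'(1)] unfolding cancels_in_def by blast
  then have "dvd_in ?P f h'"
    using primitive_over_cancels_const[OF S f(2,1) e] h' by (auto simp: cancels_in_def)
  then show "dvd_in ?P ([:c:] * f) h"
    unfolding h' by (auto simp: dvd_in_def mult_ac simp del: mult_pCons_left)
qed

text \<open>Content and primitive part are treated separately, the former in \<open>S\<close> and the latter by the Bezout
  argument. If one of the polynomials is 0, the other one is a greatest common divisor.\<close>
theorem gcd_subring_polys_over: "gcd_subring (polys_over S)"
  unfolding gcd_subring_def
proof (intro conjI ballI)
  let ?P = "polys_over S"
  show "is_subring ?P" by (rule PS)
  fix f g assume f: "f \<in> ?P" and g: "g \<in> ?P"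
  have one_zero: "cancels_in ?P 0 1" "cancels_in ?P 1 0"
    using subring_one[OF PS] by (auto simp: cancels_in_def dvd_in_def)
  consider "f = 0" | "g = 0" | "f \<noteq> 0" "g \<noteq> 0" by blast
  then show "\<exists>d\<in>?P. \<exists>f'\<in>?P. \<exists>g'\<in>?P.
    f = d * f' \<and> g = d * g' \<and> cancels_in ?P f' g' \<and> cancels_in ?P g' f'"
  proof cases
    case 1
    then show ?thesis using g one_zero subring_one[OF PS] subring_zero[OF PS]
      by (intro bexI[of _ g] bexI[of _ 0] bexI[of _ 1]) auto
  next
    case 2
    then show ?thesis using f one_zero subring_one[OF PS] subring_zero[OF PS]
      by (intro bexI[of _ f] bexI[of _ 1] bexI[of _ 0]) auto
  next
    case 3
    obtain c f0 where f0: "c \<in> S" "f0 \<in> ?P" "f = smult c f0" "primitive_over S f0"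
      using content_exists[OF f] by metis
    obtain e g0 where g0: "e \<in> S" "g0 \<in> ?P" "g = smult e g0" "primitive_over S g0"
      using content_exists[OF g] by metis
    have nz: "f0 \<noteq> 0" "g0 \<noteq> 0" "c \<noteq> 0" "e \<noteq> 0" using 3 f0 g0 by auto
    obtain r f' g' where r: "r \<in> ?P" "f' \<in> ?P" "g' \<in> ?P" "f0 = r * f'" "g0 = r * g'"
      and fg': "cancels_in ?P f' g'" "cancels_in ?P g' f'"
      using gcd_primitive[OF f0(2,4) nz(1) g0(2,4) nz(2)] by metis
    obtain d c' e' where d: "d \<in> S" "c' \<in> S" "e' \<in> S" "c = d * c'" "e = d * e'"
      and ce': "cancels_in S c' e'" "cancels_in S e' c'"
      using gcd_subringE[OF f0(1) g0(1)] by metis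
    have nz': "c' \<noteq> 0" "e' \<noteq> 0" using nz d by auto
    have prim: "primitive_over S f'" "primitive_over S g'"
      using primitive_over_factor[OF S, of f' r] primitive_over_factor[OF S, of g' r] f0 g0 r
      by (auto simp: mult.commute)
    have "f = ([:d:] * r) * ([:c':] * f')" "g = ([:d:] * r) * ([:e':] * g')"
      unfolding f0(3) g0(3) r(4,5) d(4,5) by (simp_all add: mult_ac)
    moreover have "cancels_in ?P ([:c':] * f') ([:e':] * g')"
      "cancels_in ?P ([:e':] * g') ([:c':] * f')"
      using cancels_in_const_times_primitive r prim d nz' ce' fg' by blast+
    moreover have "[:d:] * r \<in> ?P" "[:c':] * f' \<in> ?P" "[:e':] * g' \<in> ?P"
      using r d S by (simp_all add: polys_over_smult)
    ultimately show ?thesis by blast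
  qed
qed

end

lemma gcd_subring_image:
  fixes h :: "'b::idom \<Rightarrow> 'c::idom"
  assumes gcd: "gcd_subring R" and inj: "inj_on h R"
    and diff: "\<And>a b. h (a - b) = h a - h b" and mult: "\<And>a b. h (a * b) = h a * h b"
    and one: "h 1 = 1"
  shows "gcd_subring (h ` R)"
proof -
  have R: "is_subring R" by (rule gcd_is_subring[OF gcd])
  have hR: "is_subring (h ` R)"
    unfolding is_subring_def
    using subring_one[OF R] subring_diff[OF R] subring_mult[OF R]
    by (auto simp: diff[symmetric] mult[symmetric] intro!: image_eqI[of _ h] simp: one)
  have dvd: "dvd_in (h ` R) (h a) (h b) \<longleftrightarrow> dvd_in R a b" if "a \<in> R" "b \<in> R" for a b
    using that inj_onD[OF inj] subring_mult[OF R] unfolding dvd_in_def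
    by (metis (no_types, lifting) imageE imageI mult)
  have canc: "cancels_in (h ` R) (h a) (h b)" if "cancels_in R a b" "a \<in> R" "b \<in> R" for a b
    using that dvd subring_mult[OF R]
    unfolding cancels_in_def by (auto simp: mult[symmetric])
  show ?thesis
    unfolding gcd_subring_def
  proof (intro conjI ballI)
    fix a b assume "a \<in> h ` R" "b \<in> h ` R"
    then obtain p q where pq: "a = h p" "b = h q" "p \<in> R" "q \<in> R" by auto
    obtain d p' q' where "d \<in> R" "p' \<in> R" "q' \<in> R" "p = d * p'" "q = d * q'"
      "cancels_in R p' q'" "cancels_in R q' p'"
      using gcd_subringE[OF gcd pq(3,4)] by metis
    then show "\<exists>d\<in>h ` R. \<exists>a'\<in>h ` R. \<exists>b'\<in>h ` R.
      a = d * a' \<and> b = d * b' \<and> cancels_in (h ` R) a' b' \<and> cancels_in (h ` R) b' a'"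
      using pq canc
      by (intro bexI[of _ "h d"] bexI[of _ "h p'"] bexI[of _ "h q'"]) (auto simp: mult)
  qed (rule hR)
qed

section \<open>Laurent polynomials\<close>

text \<open>The set of exponent vectors is a linearly ordered group, so this is an integral domain. All
  variables \<open>x\<^sub>i\<close> with \<open>i :: nat\<close> are present; the rings used later restrict the variables that may
  occur and the ones that may be inverted.\<close>
type_synonym laurent = "(nat \<Rightarrow>\<^sub>0 int) \<Rightarrow>\<^sub>0 int"

lift_definition restrict_keys :: "('k \<Rightarrow> bool) \<Rightarrow> ('k \<Rightarrow>\<^sub>0 'b::zero) \<Rightarrow> ('k \<Rightarrow>\<^sub>0 'b)"
  is "\<lambda>Q f k. if Q k then f k else 0"
  by (rule finite_subset) auto

lemma keys_restrict_keys:
  "Poly_Mapping.keys (restrict_keys Q y) = {e \<in> Poly_Mapping.keys y. Q e}"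
  by (auto simp: in_keys_iff restrict_keys.rep_eq split: if_splits)

lemma restrict_keys_diff:
  "restrict_keys Q (u - v :: 'k \<Rightarrow>\<^sub>0 int) = restrict_keys Q u - restrict_keys Q v"
  by (rule poly_mapping_eqI) (simp add: restrict_keys.rep_eq lookup_minus)

lemma restrict_keys_add:
  "restrict_keys Q (u + v) = restrict_keys Q u + restrict_keys Q (v :: 'k \<Rightarrow>\<^sub>0 int)"
  by (rule poly_mapping_eqI) (simp add: restrict_keys.rep_eq lookup_add)

lemma restrict_keys_zero [simp]: "restrict_keys Q 0 = 0"
  by (rule poly_mapping_eqI) (simp add: restrict_keys.rep_eq)

lemma restrict_keys_sum:
  "restrict_keys Q (sum f I :: 'k \<Rightarrow>\<^sub>0 int) = (\<Sum>i\<in>I. restrict_keys Q (f i))"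
  by (induction I rule: infinite_finite_induct) (auto simp: restrict_keys_add)

lemma restrict_keys_id:
  "(\<And>e. e \<in> Poly_Mapping.keys y \<Longrightarrow> Q e) \<Longrightarrow> restrict_keys Q y = y"
  by (rule poly_mapping_eqI) (auto simp: restrict_keys.rep_eq in_keys_iff)

lemma restrict_keys_none:
  "(\<And>e. e \<in> Poly_Mapping.keys y \<Longrightarrow> \<not> Q e) \<Longrightarrow> restrict_keys Q y = 0"
  by (rule poly_mapping_eqI) (auto simp: restrict_keys.rep_eq in_keys_iff)

lemma restrict_keys_restrict_keys:
  "restrict_keys Q (restrict_keys Q' y) = restrict_keys (\<lambda>e. Q e \<and> Q' e) y"
  by (rule poly_mapping_eqI) (simp add: restrict_keys.rep_eq)

lemma restrict_keys_split:
  "(y :: 'k \<Rightarrow>\<^sub>0 int) = restrict_keys Q y + restrict_keys (\<lambda>e. \<not> Q e) y"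
  by (rule poly_mapping_eqI) (simp add: restrict_keys.rep_eq lookup_add)

lemma poly_mapping_sum_single:
  "(y :: 'k \<Rightarrow>\<^sub>0 int) = (\<Sum>e\<in>Poly_Mapping.keys y. Poly_Mapping.single e (Poly_Mapping.lookup y e))"
proof (rule poly_mapping_eqI)
  fix k
  have "(\<Sum>e\<in>Poly_Mapping.keys y. Poly_Mapping.lookup (Poly_Mapping.single e (Poly_Mapping.lookup y e)) k)
      = (\<Sum>e\<in>Poly_Mapping.keys y. if e = k then Poly_Mapping.lookup y e else 0)"
    by (rule sum.cong) (auto simp: lookup_single when_def)
  also have "\<dots> = Poly_Mapping.lookup y k"
    by (auto simp: in_keys_iff)
  finally show "Poly_Mapping.lookup y k = Poly_Mapping.lookup (\<Sum>e\<in>Poly_Mapping.keys y.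
      Poly_Mapping.single e (Poly_Mapping.lookup y e)) k"
    by (simp add: lookup_sum)
qed

lemma monomial_induct [consumes 1, case_names zero single add]:
  fixes y :: "'k \<Rightarrow>\<^sub>0 int"
  assumes "Poly_Mapping.keys y \<subseteq> K" and "Q 0"
    and "\<And>e c. e \<in> K \<Longrightarrow> Q (Poly_Mapping.single e c)"
    and "\<And>u v. Q u \<Longrightarrow> Q v \<Longrightarrow> Q (u + v)"
  shows "Q y"
proof -
  have "Q (\<Sum>e\<in>J. Poly_Mapping.single e (Poly_Mapping.lookup y e))" if "J \<subseteq> K" "finite J" for J
    using that(2,1) by (induction J rule: finite_induct) (auto intro: assms(2-4))
  from this[OF assms(1) finite_keys] show ?thesis
    using poly_mapping_sum_single[of y] by simp
qed

subsection \<open>Homogeneous components with respect to one variable\<close>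

definition comp_deg :: "nat \<Rightarrow> int \<Rightarrow> laurent \<Rightarrow> laurent" where
  "comp_deg j k y = restrict_keys (\<lambda>e. Poly_Mapping.lookup e j = k) y"

definition homog :: "nat \<Rightarrow> int \<Rightarrow> laurent \<Rightarrow> bool" where
  "homog j k y \<longleftrightarrow> (\<forall>e\<in>Poly_Mapping.keys y. Poly_Mapping.lookup e j = k)"

definition deg_ge :: "nat \<Rightarrow> int \<Rightarrow> laurent \<Rightarrow> bool" where
  "deg_ge j k y \<longleftrightarrow> (\<forall>e\<in>Poly_Mapping.keys y. k \<le> Poly_Mapping.lookup e j)"

lemma keys_multE:
  assumes "e \<in> Poly_Mapping.keys (u * v :: laurent)"
  obtains e1 e2 where "e = e1 + e2" "e1 \<in> Poly_Mapping.keys u" "e2 \<in> Poly_Mapping.keys v"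
  using assms keys_mult[of u v] by auto

lemma comp_deg_diff: "comp_deg j k (u - v) = comp_deg j k u - comp_deg j k v"
  by (simp add: comp_deg_def restrict_keys_diff)

lemma comp_deg_add: "comp_deg j k (u + v) = comp_deg j k u + comp_deg j k v"
  by (simp add: comp_deg_def restrict_keys_add)

lemma comp_deg_zero [simp]: "comp_deg j k 0 = 0"
  by (simp add: comp_deg_def)

lemma comp_deg_sum: "comp_deg j k (sum f I) = (\<Sum>i\<in>I. comp_deg j k (f i))"
  by (simp add: comp_deg_def restrict_keys_sum)

lemma keys_comp_deg:
  "Poly_Mapping.keys (comp_deg j k y) = {e \<in> Poly_Mapping.keys y. Poly_Mapping.lookup e j = k}"
  by (simp add: comp_deg_def keys_restrict_keys)

lemma homog_comp_deg: "homog j k (comp_deg j k y)"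
  by (simp add: homog_def keys_comp_deg)

lemma comp_deg_homog: "homog j a y \<Longrightarrow> comp_deg j k y = (if k = a then y else 0)"
  by (auto simp: homog_def comp_deg_def intro: restrict_keys_id restrict_keys_none)

lemma comp_deg_below: "deg_ge j a y \<Longrightarrow> k < a \<Longrightarrow> comp_deg j k y = 0"
  by (force simp: deg_ge_def comp_deg_def intro: restrict_keys_none)

lemma comp_deg_commute: "comp_deg i a (comp_deg j k y) = comp_deg j k (comp_deg i a y)"
  by (simp add: comp_deg_def restrict_keys_restrict_keys conj_commute)

lemma homog_mult: "homog j a u \<Longrightarrow> homog j k v \<Longrightarrow> homog j (a + k) (u * v)"
  by (auto simp: homog_def lookup_add elim!: keys_multE)

lemma homog_one: "homog j 0 1"
  by (simp add: homog_def)

lemma homog_power: "homog j a u \<Longrightarrow> homog j (int n * a) (u ^ n)"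
proof (induction n)
  case 0
  then show ?case by (simp add: homog_one)
next
  case (Suc n)
  then show ?case using homog_mult[of j a u "int n * a" "u ^ n"] by (simp add: algebra_simps)
qed

lemma homog_power0: "homog j 0 u \<Longrightarrow> homog j 0 (u ^ n)"
  using homog_power[of j 0 u n] by simp

lemma deg_ge_mult: "deg_ge j a u \<Longrightarrow> deg_ge j k v \<Longrightarrow> deg_ge j (a + k) (u * v)"
  by (force simp: deg_ge_def lookup_add elim!: keys_multE)

lemma deg_ge_diff: "deg_ge j a u \<Longrightarrow> deg_ge j a v \<Longrightarrow> deg_ge j a (u - v)"
  using keys_diff[of u v] by (auto simp: deg_ge_def)

lemma homog_imp_deg_ge: "homog j a u \<Longrightarrow> deg_ge j a u"
  by (simp add: homog_def deg_ge_def)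

lemma deg_ge_comp_deg: "deg_ge i a u \<Longrightarrow> deg_ge i a (comp_deg j k u)"
  by (auto simp: deg_ge_def keys_comp_deg)

lemma homog_comp_deg_other: "homog i a u \<Longrightarrow> homog i a (comp_deg j k u)"
  by (auto simp: homog_def keys_comp_deg)

lemma comp_deg_mult_homog:
  assumes "homog j a u"
  shows "comp_deg j k (u * v) = u * comp_deg j (k - a) v"
proof -
  define r where "r = restrict_keys (\<lambda>e. Poly_Mapping.lookup e j \<noteq> k - a) v"
  have v: "v = comp_deg j (k - a) v + r"
    unfolding comp_deg_def r_def by (rule restrict_keys_split)
  have "comp_deg j k (u * r) = 0"
    unfolding comp_deg_def
  proof (rule restrict_keys_none)
    fix e assume "e \<in> Poly_Mapping.keys (u * r)"
    then show "Poly_Mapping.lookup e j \<noteq> k"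
      using assms by (auto simp: r_def keys_restrict_keys homog_def lookup_add elim!: keys_multE)
  qed
  moreover have "comp_deg j k (u * comp_deg j (k - a) v) = u * comp_deg j (k - a) v"
    using comp_deg_homog[OF homog_mult[OF assms homog_comp_deg[of j "k - a" v]], of k] by simp
  ultimately show ?thesis
    by (subst v) (simp add: distrib_left comp_deg_add)
qed

text \<open>The part of lowest degree is multiplicative. When it lies in degree 0, taking it is the
  substitution of 0 for the variable.\<close>
lemma comp_deg_mult_lowest:
  assumes "deg_ge j a u" "deg_ge j k v"
  shows "comp_deg j (a + k) (u * v) = comp_deg j a u * comp_deg j k v"
proof -
  define r where "r = restrict_keys (\<lambda>e. Poly_Mapping.lookup e j \<noteq> a) u"
  have u: "u = comp_deg j a u + r"
    unfolding comp_deg_def r_def by (rule restrict_keys_split)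
  have "deg_ge j (a + 1) r"
    using assms(1) by (force simp: deg_ge_def r_def keys_restrict_keys)
  then have "comp_deg j (a + k) (r * v) = 0"
    using comp_deg_below[OF deg_ge_mult[OF _ assms(2)], of "a + 1" r "a + k"] by simp
  moreover have "comp_deg j (a + k) (comp_deg j a u * v) = comp_deg j a u * comp_deg j k v"
    using comp_deg_mult_homog[OF homog_comp_deg[of j a u], of "a + k" v] by simp
  ultimately show ?thesis
    by (subst u) (simp add: distrib_right comp_deg_add)
qed

text \<open>\<open>P\<close> has a nonzero part in degree 0, so the lowest degrees of \<open>q\<close> and of \<open>q * P\<close> agree: dividing
  by \<open>P\<close> introduces no new negative powers.\<close>
lemma deg_ge_quotient:
  assumes P: "deg_ge j 0 P" "comp_deg j 0 P \<noteq> 0" and c: "deg_ge j a (q * P)"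
  shows "deg_ge j a q"
proof (cases "q = 0")
  case True
  then show ?thesis by (simp add: deg_ge_def)
next
  case False
  define k where "k = Min ((\<lambda>e. Poly_Mapping.lookup e j) ` Poly_Mapping.keys q)"
  have ne: "(\<lambda>e. Poly_Mapping.lookup e j) ` Poly_Mapping.keys q \<noteq> {}" using False by simp
  have ge: "deg_ge j k q" by (auto simp: deg_ge_def k_def)
  have "k \<in> (\<lambda>e. Poly_Mapping.lookup e j) ` Poly_Mapping.keys q"
    unfolding k_def using ne by (intro Min_in) auto
  then have "Poly_Mapping.keys (comp_deg j k q) \<noteq> {}" by (auto simp: keys_comp_deg)
  then have "comp_deg j k q \<noteq> 0" by auto
  then have "comp_deg j k (q * P) \<noteq> 0"
    using comp_deg_mult_lowest[OF ge P(1)] P(2) by simp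
  then have "a \<le> k" using comp_deg_below[OF c] by (meson not_le)
  then show ?thesis using ge by (auto simp: deg_ge_def)
qed

lemma homog_eq_comp_deg:
  assumes "\<And>k. k \<noteq> a \<Longrightarrow> comp_deg j k y = 0"
  shows "homog j a y"
  unfolding homog_def
proof safe
  fix e assume "e \<in> Poly_Mapping.keys y"
  then have "e \<in> Poly_Mapping.keys (comp_deg j (Poly_Mapping.lookup e j) y)"
    by (simp add: keys_comp_deg)
  then show "Poly_Mapping.lookup e j = a" using assms by fastforce
qed

lemma homog_quotient:
  assumes "homog j 0 P" "P \<noteq> 0" "homog j a (q * P)"
  shows "homog j a q"
proof (rule homog_eq_comp_deg)
  fix k assume "k \<noteq> a"
  then have "comp_deg j k (P * q) = 0"
    using comp_deg_homog[OF assms(3)] by (simp add: mult.commute)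
  then show "comp_deg j k q = 0"
    using comp_deg_mult_homog[OF assms(1), of k q] assms(2) by simp
qed

lemma sum_comp_deg:
  "y = (\<Sum>a\<in>(\<lambda>e. Poly_Mapping.lookup e j) ` Poly_Mapping.keys y. comp_deg j a y)"
proof (rule poly_mapping_eqI)
  fix e
  let ?A = "(\<lambda>e. Poly_Mapping.lookup e j) ` Poly_Mapping.keys y"
  have "(\<Sum>a\<in>?A. Poly_Mapping.lookup (comp_deg j a y) e)
      = (\<Sum>a\<in>?A. if a = Poly_Mapping.lookup e j then Poly_Mapping.lookup y e else 0)"
    by (rule sum.cong) (auto simp: comp_deg_def restrict_keys.rep_eq)
  also have "\<dots> = Poly_Mapping.lookup y e"
    by (auto simp: in_keys_iff)
  finally show "Poly_Mapping.lookup y e = Poly_Mapping.lookup (\<Sum>a\<in>?A. comp_deg j a y) e"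
    by (simp add: lookup_sum)
qed

subsection \<open>The divisibility condition\<close>

text \<open>For \<open>N = 0\<close> this says that the coefficient of each negative power \<open>x\<^sub>j ^ (- k)\<close> is divisible by
  \<open>P ^ k\<close>, so if \<open>P\<close> does not involve \<open>x\<^sub>j\<close>, then \<open>y\<close> is a polynomial in \<open>x\<^sub>j\<close> and \<open>P / x\<^sub>j\<close> over
  the Laurent polynomials in the other variables. For general \<open>N\<close>, it is \<open>P ^ N\<close> times a Laurent
  polynomial in \<open>P / x\<^sub>j\<close>, and therefore the values of \<open>N\<close> add up under multiplication.\<close>
definition div_cond :: "nat \<Rightarrow> laurent \<Rightarrow> int \<Rightarrow> laurent \<Rightarrow> bool" where
  "div_cond j P N y \<longleftrightarrow> (\<forall>a. P ^ nat (N - a) dvd comp_deg j a y)"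

lemma div_cond_diff: "div_cond j P N u \<Longrightarrow> div_cond j P N v \<Longrightarrow> div_cond j P N (u - v)"
  by (simp add: div_cond_def comp_deg_diff)

lemma div_cond_mult:
  assumes u: "div_cond j P N u" and v: "div_cond j P N' v"
  shows "div_cond j P (N + N') (u * v)"
  unfolding div_cond_def
proof
  fix k
  let ?A = "(\<lambda>e. Poly_Mapping.lookup e j) ` Poly_Mapping.keys u"
  have "u * v = (\<Sum>a\<in>?A. comp_deg j a u * v)"
    by (subst sum_comp_deg[of u j]) (simp add: sum_distrib_right)
  then have "comp_deg j k (u * v) = (\<Sum>a\<in>?A. comp_deg j k (comp_deg j a u * v))"
    by (simp add: comp_deg_sum)
  also have "\<dots> = (\<Sum>a\<in>?A. comp_deg j a u * comp_deg j (k - a) v)"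
    by (simp add: comp_deg_mult_homog[OF homog_comp_deg])
  also have "P ^ nat (N + N' - k) dvd \<dots>"
  proof (rule dvd_sum)
    fix a
    have "P ^ nat (N - a) * P ^ nat (N' - (k - a)) dvd comp_deg j a u * comp_deg j (k - a) v"
      using u v unfolding div_cond_def by (intro mult_dvd_mono) blast+
    moreover have "nat (N + N' - k) \<le> nat (N - a) + nat (N' - (k - a))" by simp
    ultimately show "P ^ nat (N + N' - k) dvd comp_deg j a u * comp_deg j (k - a) v"
      unfolding power_add[symmetric] by (rule dvd_trans[OF le_imp_power_dvd, rotated])
  qed
  finally show "P ^ nat (N + N' - k) dvd comp_deg j k (u * v)" .
qed

lemma div_cond_homog: "homog j a u \<Longrightarrow> P ^ nat (N - a) dvd u \<Longrightarrow> div_cond j P N u"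
  by (auto simp: div_cond_def comp_deg_homog)

lemma div_cond_deg_ge:
  assumes "deg_ge j N u"
  shows "div_cond j P N u"
  unfolding div_cond_def
proof
  fix a
  show "P ^ nat (N - a) dvd comp_deg j a u"
    using comp_deg_below[OF assms, of a] by (cases "a < N") auto
qed

lemma div_cond_unit: "P dvd 1 \<Longrightarrow> div_cond j P N u"
  unfolding div_cond_def
  using dvd_power_same[of P 1] by (metis dvd_trans one_dvd power_one)

subsection \<open>Monomials and subrings\<close>

definition var :: "nat \<Rightarrow> laurent" where
  "var i = Poly_Mapping.single (Poly_Mapping.single i 1) 1"

definition var_inv :: "nat \<Rightarrow> laurent" where
  "var_inv i = Poly_Mapping.single (Poly_Mapping.single i (-1)) 1"

lemma var_var_inv: "var i * var_inv i = 1"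
  by (simp add: var_def var_inv_def mult_single flip: single_add)

lemma homog_single: "homog j (Poly_Mapping.lookup e j) (Poly_Mapping.single e c)"
  by (simp add: homog_def)

lemma homog_var: "homog j (if j = i then 1 else 0) (var i)"
  by (simp add: homog_def var_def lookup_single when_def)

lemma homog_var_inv: "homog j (if j = i then -1 else 0) (var_inv i)"
  by (simp add: homog_def var_inv_def lookup_single when_def)

lemma single_unit: "Poly_Mapping.single e (1::int) * Poly_Mapping.single (- e) 1 = (1 :: laurent)"
  by (simp add: mult_single)

lemma var_power: "var i ^ k = Poly_Mapping.single (Poly_Mapping.single i (int k)) 1"
  by (induction k) (simp_all add: var_def mult_single flip: single_add)

lemma var_inv_power: "var_inv i ^ k = Poly_Mapping.single (Poly_Mapping.single i (- int k)) 1"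
  by (induction k) (simp_all add: var_inv_def mult_single flip: single_add)

definition laurent_ring :: "nat set \<Rightarrow> laurent set" where
  "laurent_ring V = {y. \<forall>j. j \<notin> V \<longrightarrow> homog j 0 y}"

definition poly_ring :: "nat set \<Rightarrow> laurent set" where
  "poly_ring V = {y \<in> laurent_ring V. \<forall>j. deg_ge j 0 y}"

lemma homog_diff: "homog j a u \<Longrightarrow> homog j a v \<Longrightarrow> homog j a (u - v)"
  using keys_diff[of u v] by (auto simp: homog_def)

lemma is_subring_laurent_ring: "is_subring (laurent_ring V)"
  unfolding is_subring_def laurent_ring_def
  using homog_diff homog_one homog_mult[of _ 0 _ 0] by auto

lemma is_subring_poly_ring: "is_subring (poly_ring V)"
  using is_subring_laurent_ring[of V]
  unfolding is_subring_def poly_ring_def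
  using deg_ge_diff homog_imp_deg_ge[OF homog_one] deg_ge_mult[of _ 0 _ 0] by auto

lemma poly_ring_mono: "V \<subseteq> V' \<Longrightarrow> poly_ring V \<subseteq> poly_ring V'"
  by (auto simp: poly_ring_def laurent_ring_def)

lemma var_in_poly_ring: "i \<in> V \<Longrightarrow> var i \<in> poly_ring V"
  by (auto simp: poly_ring_def laurent_ring_def deg_ge_def var_def lookup_single when_def homog_def)

lemma gcd_subring_int: "gcd_subring (UNIV :: int set)"
  unfolding gcd_subring_def
proof (intro conjI ballI)
  show "is_subring (UNIV :: int set)" by (simp add: is_subring_def)
  have canc: "cancels_in UNIV p q" if "coprime p q" for p q :: int
    using that by (simp add: cancels_in_def dvd_in_def flip: dvd_def)
      (simp add: coprime_dvd_mult_right_iff)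
  fix a b :: int
  have "\<exists>p q. a = gcd a b * p \<and> b = gcd a b * q \<and> coprime p q"
  proof (cases "gcd a b = 0")
    case True
    then show ?thesis by (intro exI[of _ 1]) auto
  next
    case False
    then show ?thesis using gcd_coprime_exists[OF False] by (metis mult.commute)
  qed
  then show "\<exists>d\<in>UNIV. \<exists>a'\<in>UNIV. \<exists>b'\<in>UNIV.
      a = d * a' \<and> b = d * b' \<and> cancels_in UNIV a' b' \<and> cancels_in UNIV b' a'"
    using canc by (metis UNIV_I coprime_commute)
qed

lemma poly_ring_empty: "poly_ring {} = range of_int"
proof
  show "range of_int \<subseteq> poly_ring {}"
    using subring_of_int[OF is_subring_poly_ring] by auto
  show "poly_ring {} \<subseteq> range of_int"
  proof
    fix y assume "y \<in> poly_ring {}"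
    then have "\<forall>e\<in>Poly_Mapping.keys y. \<forall>j. Poly_Mapping.lookup e j = 0"
      by (simp add: poly_ring_def laurent_ring_def homog_def)
    then have "Poly_Mapping.keys y \<subseteq> {0}"
      by (auto intro: poly_mapping_eqI)
    then have "y \<in> range of_int"
    proof (induction rule: monomial_induct)
      case zero
      show ?case by (metis of_int_0 rangeI)
    next
      case (single e c)
      then have "Poly_Mapping.single e c = of_int c"
        using single_of_int[of c, where ?'b = int] by (simp del: single_of_int)
      then show ?case by (metis rangeI)
    next
      case (add u v)
      then show ?case by (metis (no_types, lifting) imageE of_int_add rangeI)
    qed
    then show "y \<in> range of_int" .
  qed
qed

text \<open>The polynomial ring in the variables \<open>insert v V\<close> is the image of the univariate polynomials over
  the polynomial ring in \<open>V\<close> under evaluation at \<open>var v\<close>, which is injective because the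
  coefficient of \<open>X ^ k\<close> is recovered from the part of degree \<open>k\<close> in \<open>v\<close>.\<close>
theorem gcd_subring_poly_ring:
  assumes "finite V"
  shows "gcd_subring (poly_ring V)"
  using assms
proof (induction V rule: finite_induct)
  case empty
  have "gcd_subring (range (of_int :: int \<Rightarrow> laurent))"
    by (rule gcd_subring_image[OF gcd_subring_int]) (auto intro: inj_onI)
  then show ?case by (simp add: poly_ring_empty)
next
  case (insert v V)
  let ?h = "\<lambda>p. poly p (var v)"
  let ?R = "polys_over (poly_ring V)"
  have coeff: "homog v 0 (coeff p i)" if "p \<in> ?R" for p i
    using that insert.hyps by (auto simp: polys_over_def poly_ring_def laurent_ring_def)
  have comp: "comp_deg v (int k) (?h p) = coeff p k * var v ^ k" if p: "p \<in> ?R" for p k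
  proof -
    have "comp_deg v (int k) (?h p) = (\<Sum>i\<le>degree p. comp_deg v (int k) (coeff p i * var v ^ i))"
      by (simp add: poly_altdef comp_deg_sum)
    also have "\<dots> = (\<Sum>i\<le>degree p. if i = k then coeff p i * var v ^ i else 0)"
    proof (rule sum.cong)
      fix i
      have "homog v 1 (var v)" using homog_var[of v v] by simp
      from homog_mult[OF coeff[OF p] homog_power[OF this]]
      have "homog v (int i) (coeff p i * var v ^ i)" by simp
      then show "comp_deg v (int k) (coeff p i * var v ^ i)
          = (if i = k then coeff p i * var v ^ i else 0)"
        by (auto simp: comp_deg_homog)
    qed simp
    also have "\<dots> = coeff p k * var v ^ k"
      by (auto simp: coeff_eq_0)
    finally show ?thesis .
  qed
  have inj: "inj_on ?h ?R"
  proof (rule inj_onI)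
    fix p q assume p: "p \<in> ?R" and q: "q \<in> ?R" and eq: "?h p = ?h q"
    have "coeff p k = coeff q k" for k
    proof -
      have "coeff p k * var v ^ k = coeff q k * var v ^ k"
        using comp[OF p] comp[OF q] eq by metis
      then show ?thesis
        using var_var_inv[of v] by (metis mult_right_cancel power_eq_0_iff mult_zero_left zero_neq_one)
    qed
    then show "p = q" by (rule poly_eqI)
  qed
  have img: "gcd_subring (?h ` ?R)"
    by (rule gcd_subring_image[OF gcd_subring_polys_over[OF insert.IH] inj]) auto
  have "?h ` ?R = poly_ring (insert v V)"
  proof
    show "?h ` ?R \<subseteq> poly_ring (insert v V)"
    proof clarify
      fix p assume p: "p \<in> ?R"
      have sub: "is_subring (poly_ring (insert v V))" by (rule is_subring_poly_ring)
      have "coeff p i \<in> poly_ring (insert v V)" for i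
        using p poly_ring_mono[of V "insert v V"] by (auto simp: polys_over_def)
      then show "?h p \<in> poly_ring (insert v V)"
        unfolding poly_altdef
        using var_in_poly_ring[of v "insert v V"]
        by (intro subring_sum[OF sub] subring_mult[OF sub] subring_power[OF sub]) auto
    qed
    show "poly_ring (insert v V) \<subseteq> ?h ` ?R"
    proof
      fix y assume "y \<in> poly_ring (insert v V)"
      then have "Poly_Mapping.keys y \<subseteq> {e. \<forall>j. 0 \<le> Poly_Mapping.lookup e j \<and>
          (j \<notin> insert v V \<longrightarrow> Poly_Mapping.lookup e j = 0)}"
        by (auto simp: poly_ring_def laurent_ring_def homog_def deg_ge_def)
      then show "y \<in> ?h ` ?R"
      proof (induction rule: monomial_induct)
        case zero
        show ?case by (rule image_eqI[of _ _ 0]) (auto intro: subring_zero polys_over_subring is_subring_poly_ring)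
      next
        case (single e c)
        define k where "k = nat (Poly_Mapping.lookup e v)"
        define e' where "e' = e - Poly_Mapping.single v (int k)"
        have e'v: "Poly_Mapping.lookup e' j = (if j = v then 0 else Poly_Mapping.lookup e j)" for j
          using single by (auto simp: e'_def k_def lookup_minus lookup_single when_def)
        have "Poly_Mapping.single e' c \<in> poly_ring V"
          using single by (auto simp: poly_ring_def laurent_ring_def homog_def deg_ge_def e'v)
        then have "monom (Poly_Mapping.single e' c) k \<in> ?R"
          using polys_over_monom[OF is_subring_poly_ring] by blast
        moreover have "?h (monom (Poly_Mapping.single e' c) k) = Poly_Mapping.single e c"
          by (simp add: poly_monom var_power mult_single e'_def)
        ultimately show ?case by (metis imageI)
      next
        case (add u w)
        then show ?case using subring_add[OF gcd_is_subring[OF img]] by blast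
      qed
    qed
  qed
  then show ?case using img by simp
qed

lemma dvd_unit_mult:
  fixes u :: "'b::comm_ring_1"
  assumes "u dvd 1" "p dvd u * g"
  shows "p dvd g"
proof -
  obtain w where "1 = u * w" using assms(1) by (auto simp: dvd_def)
  then have "g = u * g * w" by (metis mult.assoc mult.commute mult_1)
  then show ?thesis using assms(2) by (metis dvd_mult2)
qed

lemma single_unit_dvd: "Poly_Mapping.single e (1::int) dvd (1 :: laurent)"
  using single_unit[of e] by (metis dvd_triv_left)

lemma laurent_denominator:
  assumes "y \<in> laurent_ring V" "finite V"
  obtains M where "Poly_Mapping.single M 1 \<in> poly_ring V" "Poly_Mapping.single M 1 * y \<in> poly_ring V"
proof -
  define C where "C i = Max (insert 0 ((\<lambda>e. - Poly_Mapping.lookup e i) ` Poly_Mapping.keys y))" for i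
  have C: "0 \<le> C i" "e \<in> Poly_Mapping.keys y \<Longrightarrow> - Poly_Mapping.lookup e i \<le> C i" for i e
    unfolding C_def by (auto intro: Max_ge)
  define M where "M = (\<Sum>i\<in>V. Poly_Mapping.single i (C i))"
  have "Poly_Mapping.lookup M j = (\<Sum>i\<in>V. if i = j then C i else 0)" for j
    unfolding M_def lookup_sum by (rule sum.cong) (auto simp: lookup_single when_def)
  then have M: "Poly_Mapping.lookup M j = (if j \<in> V then C j else 0)" for j
    using assms(2) by simp
  have 1: "Poly_Mapping.single M 1 \<in> poly_ring V"
    using C by (auto simp: poly_ring_def laurent_ring_def homog_def deg_ge_def M)
  then have "Poly_Mapping.single M 1 * y \<in> laurent_ring V"
    using subring_mult[OF is_subring_laurent_ring] assms(1) by (auto simp: poly_ring_def)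
  moreover have "deg_ge j 0 (Poly_Mapping.single M 1 * y)" for j
    unfolding deg_ge_def
  proof
    fix e assume "e \<in> Poly_Mapping.keys (Poly_Mapping.single M 1 * y)"
    then obtain e2 where e: "e = M + e2" "e2 \<in> Poly_Mapping.keys y"
      by (auto elim!: keys_multE)
    have "j \<notin> V \<Longrightarrow> Poly_Mapping.lookup e2 j = 0"
      using assms(1) e by (auto simp: laurent_ring_def homog_def)
    then show "0 \<le> Poly_Mapping.lookup e j"
      using C(2)[OF e(2), of j] by (auto simp: e lookup_add M)
  qed
  ultimately show thesis using that 1 by (auto simp: poly_ring_def)
qed

lemma dvd_laurent_ring:
  assumes "p \<in> laurent_ring V" "p \<noteq> 0" "p * h \<in> laurent_ring V"
  shows "h \<in> laurent_ring V"
  using assms homog_quotient[of _ p 0 h] by (auto simp: laurent_ring_def mult.commute)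

text \<open>Monomials clear the denominators of \<open>g\<close> and of the quotient, and they are units among the Laurent
  polynomials.\<close>
lemma cancels_poly_ring_imp_laurent:
  assumes V: "finite V" and c: "cancels_in (poly_ring V) p q"
    and mem: "p \<in> poly_ring V" "q \<in> poly_ring V" "p \<noteq> 0"
    and g: "g \<in> laurent_ring V" and dvd: "p dvd q * g"
  shows "p dvd g"
proof -
  have sub: "is_subring (laurent_ring V)" "is_subring (poly_ring V)"
    by (rule is_subring_laurent_ring is_subring_poly_ring)+
  obtain h where h: "q * g = p * h" using dvd by (auto simp: dvd_def)
  have pq: "p \<in> laurent_ring V" "q \<in> laurent_ring V" using mem by (auto simp: poly_ring_def)
  then have hV: "h \<in> laurent_ring V"
    using dvd_laurent_ring[of p V h] mem(3) h subring_mult[OF sub(1) pq(2) g] by simp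
  obtain M where M: "Poly_Mapping.single M 1 \<in> poly_ring V" "Poly_Mapping.single M 1 * g \<in> poly_ring V"
    using laurent_denominator[OF g V] by blast
  obtain M' where M': "Poly_Mapping.single M' 1 \<in> poly_ring V" "Poly_Mapping.single M' 1 * h \<in> poly_ring V"
    using laurent_denominator[OF hV V] by blast
  let ?u = "Poly_Mapping.single M 1 :: laurent" and ?u' = "Poly_Mapping.single M' 1 :: laurent"
  have g': "?u' * (?u * g) \<in> poly_ring V" and h': "?u * (?u' * h) \<in> poly_ring V"
    using subring_mult[OF sub(2)] M M' by auto
  have "q * (?u' * (?u * g)) = ?u' * ?u * (q * g)" by (simp only: mult_ac)
  also have "\<dots> = p * (?u * (?u' * h))" unfolding h by (simp only: mult_ac)
  finally have "dvd_in (poly_ring V) p (q * (?u' * (?u * g)))" using h' unfolding dvd_in_def by blast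
  then have "dvd_in (poly_ring V) p (?u' * (?u * g))" using c g' by (auto simp: cancels_in_def)
  then have "p dvd ?u' * (?u * g)" by (auto simp: dvd_in_def)
  then show ?thesis
    using dvd_unit_mult[OF single_unit_dvd] by blast
qed

lemma cancels_powers:
  fixes p q :: laurent
  assumes p: "p \<in> laurent_ring V" "p \<noteq> 0" and q: "q \<in> laurent_ring V" and g: "g \<in> laurent_ring V"
    and canc: "\<And>g. g \<in> laurent_ring V \<Longrightarrow> p dvd q * g \<Longrightarrow> p dvd g"
    and dvd: "p ^ k dvd q ^ N * g"
  shows "p ^ k dvd g"
proof -
  have sub: "is_subring (laurent_ring V)" by (rule is_subring_laurent_ring)
  have canc': "p dvd g" if "g \<in> laurent_ring V" "p dvd q ^ N * g" for g
    using that(2)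
  proof (induction N)
    case (Suc N)
    have "q ^ N * g \<in> laurent_ring V" using subring_mult[OF sub] subring_power[OF sub] q that by blast
    moreover have "p dvd q * (q ^ N * g)" using Suc.prems by (simp only: power_Suc mult.assoc)
    ultimately show ?case using canc Suc.IH by blast
  qed simp
  show ?thesis using dvd g
  proof (induction k arbitrary: g)
    case (Suc k)
    have "p dvd p ^ Suc k" by simp
    then have "p dvd q ^ N * g" using Suc.prems(1) by (rule dvd_trans)
    then obtain g' where g': "g = p * g'" using canc' Suc.prems by (auto simp: dvd_def)
    have "p * p ^ k dvd p * (q ^ N * g')" using Suc.prems(1) g' by (simp add: mult_ac)
    then have "p ^ k dvd q ^ N * g'" using p(2) by simp
    moreover have "g' \<in> laurent_ring V"
      using dvd_laurent_ring[OF p] Suc.prems(2) unfolding g' by blast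
    ultimately have "p ^ k dvd g'" by (rule Suc.IH)
    then show ?case unfolding g' power_Suc by (rule mult_dvd_mono[OF dvd_refl])
  qed simp
qed

section \<open>Elimination along an acyclic graph\<close>

text \<open>The properties of the exchange polynomials on which the elimination depends, freed from their
  explicit form. The variables are indexed by \<open>V\<close>, those of the cluster by \<open>N\<close>. If there is an edge
  from \<open>i\<close> to \<open>j\<close>, setting \<open>x\<^sub>i = 0\<close> turns \<open>P\<^sub>j\<close> into a monomial with exponent vector \<open>M j\<close>,
  which involves of the cluster variables only those at the end of an edge from \<open>j\<close>.\<close>
locale acyclic_exchange =
  fixes V N :: "nat set" and P :: "nat \<Rightarrow> laurent" and M :: "nat \<Rightarrow> nat \<Rightarrow>\<^sub>0 int"
    and b :: "nat \<Rightarrow> nat \<Rightarrow> int"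
  assumes finite_V: "finite V" and N_subset: "N \<subseteq> V"
    and P_poly: "\<And>j. j \<in> N \<Longrightarrow> P j \<in> poly_ring V"
    and P_nonzero: "\<And>j. j \<in> N \<Longrightarrow> P j \<noteq> 0"
    and P_homog: "\<And>i j. \<lbrakk>i \<in> N; j \<in> N; b i j = 0\<rbrakk> \<Longrightarrow> homog i 0 (P j)"
    and P_degenerate: "\<And>i j. \<lbrakk>i \<in> N; j \<in> N; b i j > 0\<rbrakk> \<Longrightarrow>
      comp_deg i 0 (P j) = Poly_Mapping.single (M j) 1"
    and M_zero: "\<And>i j. \<lbrakk>i \<in> N; j \<in> N; b i j \<ge> 0\<rbrakk> \<Longrightarrow> Poly_Mapping.lookup (M j) i = 0"
    and b_sign: "\<And>i j. \<lbrakk>i \<in> N; j \<in> N\<rbrakk> \<Longrightarrow> b i j > 0 \<longleftrightarrow> b j i < 0"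
    and acyclic_b: "acyclic {(i, j). i \<in> N \<and> j \<in> N \<and> b i j > 0}"
    and P_cancels: "\<And>i j g. \<lbrakk>i \<in> N; j \<in> N; i \<noteq> j; g \<in> laurent_ring V; P j dvd P i * g\<rbrakk> \<Longrightarrow> P j dvd g"
begin

lemma b_zero: "i \<in> N \<Longrightarrow> j \<in> N \<Longrightarrow> b i j = 0 \<Longrightarrow> b j i = 0"
  using b_sign[of i j] b_sign[of j i] by linarith

lemma b_diag: "i \<in> N \<Longrightarrow> b i i = 0"
  using b_sign[of i i] by linarith

text \<open>The polynomial \<open>P\<^sub>j\<close> after the substitution \<open>x\<^sub>i = 0\<close> for all \<open>i \<in> Z\<close>.\<close>
definition specialize :: "nat set \<Rightarrow> nat \<Rightarrow> laurent" where
  "specialize Z j = restrict_keys (\<lambda>e. \<forall>i\<in>Z. Poly_Mapping.lookup e i = 0) (P j)"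

definition exchanged :: "nat set \<Rightarrow> nat \<Rightarrow> laurent" where
  "exchanged Z j = var_inv j * specialize Z j"

text \<open>\<open>lower_alg\<close> and \<open>upper_alg\<close> are the lower and the upper bound at a stage of the elimination: the
  variables in \<open>Z\<close> have been set to 0, those in \<open>W\<close> occur polynomially without an exchanged
  partner, and those in \<open>T\<close> are still to be eliminated. All other variables are frozen and
  invertible.\<close>
definition lower_alg :: "nat set \<Rightarrow> nat set \<Rightarrow> nat set \<Rightarrow> laurent set" where
  "lower_alg Z W T = subring_gen (var ` (V - N) \<union> var_inv ` (V - N) \<union> var ` (W \<union> T) \<union> exchanged Z ` T)"

definition upper_alg :: "nat set \<Rightarrow> nat set \<Rightarrow> nat set \<Rightarrow> laurent set" where
  "upper_alg Z W T = {y \<in> laurent_ring (V - Z).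
     (\<forall>i\<in>W. deg_ge i 0 y) \<and> (\<forall>j\<in>T. div_cond j (specialize Z j) 0 y)}"

text \<open>The last condition says that no edge leads from a vertex in \<open>T\<close> to one that has been processed.\<close>
definition stage :: "nat set \<Rightarrow> nat set \<Rightarrow> nat set \<Rightarrow> bool" where
  "stage Z W T \<longleftrightarrow> N = Z \<union> W \<union> T \<and> Z \<inter> W = {} \<and> Z \<inter> T = {} \<and> W \<inter> T = {} \<and>
     (\<forall>i\<in>Z \<union> W. \<forall>j\<in>T. b i j \<ge> 0)"

lemma specialize_insert: "specialize (insert t Z) j = comp_deg t 0 (specialize Z j)"
  by (simp add: specialize_def comp_deg_def restrict_keys_restrict_keys)

lemma keys_specialize: "Poly_Mapping.keys (specialize Z j) \<subseteq> Poly_Mapping.keys (P j)"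
  by (auto simp: specialize_def keys_restrict_keys)

lemma homog_specialize: "homog i 0 (P j) \<Longrightarrow> homog i 0 (specialize Z j)"
  using keys_specialize[of Z j] by (auto simp: homog_def)

lemma homog_specialize_Z: "i \<in> Z \<Longrightarrow> homog i 0 (specialize Z j)"
  by (auto simp: homog_def specialize_def keys_restrict_keys)

lemma deg_ge_specialize: "j \<in> N \<Longrightarrow> deg_ge i 0 (specialize Z j)"
  using P_poly[of j] keys_specialize[of Z j] by (auto simp: poly_ring_def deg_ge_def)

lemma specialize_laurent_ring: "j \<in> N \<Longrightarrow> specialize Z j \<in> laurent_ring (V - Z)"
  using P_poly[of j] homog_specialize homog_specialize_Z by (auto simp: laurent_ring_def poly_ring_def)

text \<open>If some neighbour of \<open>j\<close> is set to 0, it lies at the start of an edge to \<open>j\<close>, so \<open>P\<^sub>j\<close> becomes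
  the monomial \<open>M j\<close>. Setting further predecessors of \<open>j\<close> to 0 changes nothing, as they do not occur
  in that monomial.\<close>
lemma specialize_cases:
  assumes "j \<in> N" "Z \<subseteq> N" "\<forall>i\<in>Z. b i j \<ge> 0"
  obtains "\<forall>i\<in>Z. b i j = 0" "specialize Z j = P j"
  | i where "i \<in> Z" "b i j > 0" "specialize Z j = Poly_Mapping.single (M j) 1"
proof (cases "\<forall>i\<in>Z. b i j = 0")
  case True
  have "specialize Z j = P j"
    unfolding specialize_def
  proof (rule restrict_keys_id, rule ballI)
    fix e i assume "e \<in> Poly_Mapping.keys (P j)" "i \<in> Z"
    then show "Poly_Mapping.lookup e i = 0"
      using P_homog[of i j] True assms by (auto simp: homog_def)
  qed
  then show ?thesis using that True by blast
next
  case False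
  then obtain i where i: "i \<in> Z" "b i j > 0" using assms(3) by force
  have "specialize Z j = specialize (insert i Z) j" using i by (simp add: insert_absorb)
  also have "\<dots> = restrict_keys (\<lambda>e. \<forall>i\<in>Z. Poly_Mapping.lookup e i = 0) (comp_deg i 0 (P j))"
    by (simp add: specialize_def comp_deg_def restrict_keys_restrict_keys conj_commute)
  also have "\<dots> = restrict_keys (\<lambda>e. \<forall>i\<in>Z. Poly_Mapping.lookup e i = 0) (Poly_Mapping.single (M j) 1)"
    using P_degenerate[of i j] i assms by auto
  also have "\<dots> = Poly_Mapping.single (M j) 1"
    using M_zero assms by (intro restrict_keys_id) auto
  finally show ?thesis using that(2)[OF i] by blast
qed

lemma specialize_nonzero:
  assumes "j \<in> N" "Z \<subseteq> N" "\<forall>i\<in>Z. b i j \<ge> 0"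
  shows "specialize Z j \<noteq> 0"
  using specialize_cases[OF assms] P_nonzero[OF assms(1)] by (metis single_unit mult_zero_left zero_neq_one)

lemma specialize_unit:
  assumes "j \<in> N" "Z \<subseteq> N" "\<forall>i\<in>Z. b i j \<ge> 0" "i \<in> Z" "b i j > 0"
  shows "specialize Z j dvd 1"
  using specialize_cases[OF assms(1-3)] assms(4,5) single_unit_dvd by (metis less_irrefl)

lemma specialize_cancels:
  assumes i: "i \<in> N" "Z \<subseteq> N" "\<forall>k\<in>Z. b k i \<ge> 0"
    and j: "j \<in> N" "\<forall>k\<in>Z. b k j \<ge> 0" and ij: "i \<noteq> j"
    and g: "g \<in> laurent_ring V" and dvd: "specialize Z j dvd specialize Z i * g"
  shows "specialize Z j dvd g"
proof (cases "specialize Z j dvd 1")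
  case True
  then show ?thesis by (metis dvd_trans one_dvd)
next
  case nj: False
  then have Pj: "specialize Z j = P j"
    using specialize_cases[OF j(1) i(2) j(2)] single_unit_dvd by metis
  show ?thesis
  proof (cases "specialize Z i dvd 1")
    case True
    then show ?thesis using dvd_unit_mult dvd by blast
  next
    case False
    then have "specialize Z i = P i"
      using specialize_cases[OF i] single_unit_dvd by metis
    then show ?thesis using P_cancels[OF i(1) j(1) ij g] dvd Pj by simp
  qed
qed

lemma is_subring_upper_alg: "is_subring (upper_alg Z W T)"
proof -
  have one: "deg_ge i 0 1" "div_cond j p 0 1" for i j p
    using homog_imp_deg_ge[OF homog_one] div_cond_deg_ge by auto
  show ?thesis
    using is_subring_laurent_ring[of "V - Z"] one deg_ge_diff deg_ge_mult[of _ 0 _ 0]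
      div_cond_diff div_cond_mult[of _ _ 0 _ 0]
    unfolding is_subring_def upper_alg_def by auto
qed

lemma poly_in_upper_alg:
  assumes "y \<in> laurent_ring (V - Z)" "\<And>i. i \<in> W \<union> T \<Longrightarrow> deg_ge i 0 y"
  shows "y \<in> upper_alg Z W T"
  using assms div_cond_deg_ge by (auto simp: upper_alg_def)

lemma var_deg_ge: "deg_ge j 0 (var i)"
  by (simp add: deg_ge_def var_def lookup_single when_def)

lemma var_inv_deg_ge: "i \<noteq> j \<Longrightarrow> deg_ge j 0 (var_inv i)"
  by (simp add: deg_ge_def var_inv_def lookup_single when_def)

lemma var_in_laurent_ring: "i \<in> U \<Longrightarrow> var i \<in> laurent_ring U"
  by (auto simp: laurent_ring_def homog_def var_def lookup_single when_def)

lemma var_inv_in_laurent_ring: "i \<in> U \<Longrightarrow> var_inv i \<in> laurent_ring U"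
  by (auto simp: laurent_ring_def homog_def var_inv_def lookup_single when_def)

lemma homog_exchanged: "j \<in> N \<Longrightarrow> homog j (-1) (exchanged Z j)"
  using homog_mult[OF homog_var_inv[of j j] homog_specialize[OF P_homog[of j j]], of Z] b_diag
  by (simp add: exchanged_def)

lemma homog_exchanged_other:
  "i \<in> N \<Longrightarrow> j \<in> N \<Longrightarrow> b i j = 0 \<Longrightarrow> i \<noteq> j \<Longrightarrow> homog i 0 (exchanged Z j)"
  using homog_mult[OF homog_var_inv[of i j] homog_specialize[OF P_homog[of i j]], of Z]
  by (simp add: exchanged_def)

lemma deg_ge_exchanged: "j \<in> N \<Longrightarrow> i \<noteq> j \<Longrightarrow> deg_ge i 0 (exchanged Z j)"
  using deg_ge_mult[OF var_inv_deg_ge[of j i] deg_ge_specialize[of j i Z]] by (simp add: exchanged_def)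

lemma lower_alg_subset_upper_alg:
  assumes st: "stage Z W T"
  shows "lower_alg Z W T \<subseteq> upper_alg Z W T"
proof
  note R = is_subring_upper_alg[of Z W T]
  fix y assume "y \<in> lower_alg Z W T"
  then show "y \<in> upper_alg Z W T"
    unfolding lower_alg_def
  proof (induction rule: subring_gen.induct)
    case one
    show ?case by (rule subring_one[OF R])
  next
    case (diff u v)
    from diff.IH show ?case by (rule subring_diff[OF R])
  next
    case (mult u v)
    from mult.IH show ?case by (rule subring_mult[OF R])
  next
    case (base y)
    then consider i where "y = var i" "i \<in> V - N \<union> (W \<union> T)"
      | i where "y = var_inv i" "i \<in> V - N"
      | j where "y = exchanged Z j" "j \<in> T"
      by blast
    then show ?case
    proof cases
      case 1
      then have "i \<in> V - Z" using st N_subset unfolding stage_def by blast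
      then show ?thesis unfolding 1 by (intro poly_in_upper_alg var_in_laurent_ring var_deg_ge)
    next
      case 2
      then show ?thesis using st
        by (auto intro!: poly_in_upper_alg var_inv_in_laurent_ring var_inv_deg_ge simp: stage_def)
    next
      case 3
      then have j: "j \<in> N" "j \<in> V - Z" using st N_subset by (auto simp: stage_def)
      have "exchanged Z j \<in> laurent_ring (V - Z)"
        unfolding exchanged_def
        by (rule subring_mult[OF is_subring_laurent_ring var_inv_in_laurent_ring[OF j(2)]
              specialize_laurent_ring[OF j(1)]])
      moreover have "deg_ge i 0 (exchanged Z j)" if "i \<in> W" for i
      proof (rule deg_ge_exchanged[OF j(1)])
        show "i \<noteq> j" using that 3(2) st by (auto simp: stage_def)
      qed
      moreover have "div_cond i (specialize Z i) 0 (exchanged Z j)" for i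
      proof (cases "i = j")
        case True
        have "specialize Z j dvd exchanged Z j" by (simp add: exchanged_def)
        then show ?thesis using div_cond_homog[OF homog_exchanged[OF j(1)], of "specialize Z j" 0 Z] True by simp
      next
        case False
        then show ?thesis by (intro div_cond_deg_ge deg_ge_exchanged[OF j(1)])
      qed
      ultimately show ?thesis using 3 by (simp add: upper_alg_def)
    qed
  qed
qed

lemma is_subring_subring_gen: "is_subring (subring_gen G)" for G :: "laurent set"
  by (auto simp: is_subring_def intro: subring_gen.intros)

lemma subring_gen_mono:
  assumes "G \<subseteq> subring_gen H"
  shows "subring_gen G \<subseteq> subring_gen H"
proof
  fix y assume "y \<in> subring_gen G"
  then show "y \<in> subring_gen H"
    by induction (use assms in \<open>auto intro: subring_gen.intros\<close>)
qed

lemma is_subring_lower_alg: "is_subring (lower_alg Z W T)"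
  by (simp add: lower_alg_def is_subring_subring_gen)

lemma stage_zero:
  assumes "stage Z W (insert t T)" "t \<notin> T" "\<forall>j\<in>T. b t j \<ge> 0"
  shows "stage (insert t Z) W T"
  using assms unfolding stage_def by auto

lemma stage_poly:
  assumes "stage Z W (insert t T)" "t \<notin> T" "\<forall>j\<in>T. b t j \<ge> 0"
  shows "stage Z (insert t W) T"
  using assms unfolding stage_def by auto

text \<open>Replacing every specialised generator by the corresponding generator with \<open>x\<^sub>t\<close> restored lifts a
  polynomial expression along the substitution \<open>x\<^sub>t = 0\<close>; on elements without negative powers of
  \<open>x\<^sub>t\<close> that substitution is a ring homomorphism.\<close>
lemma lift_from_zero:
  assumes st: "stage Z W (insert t T)" "t \<notin> T" and e: "e \<in> lower_alg (insert t Z) W T"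
  shows "\<exists>f\<in>lower_alg Z W (insert t T). deg_ge t 0 f \<and> comp_deg t 0 f = e"
  using e unfolding lower_alg_def[of "insert t Z"]
proof (induction rule: subring_gen.induct)
  case one
  show ?case
    using subring_one[OF is_subring_lower_alg] homog_imp_deg_ge[OF homog_one]
      comp_deg_homog[OF homog_one, of t 0] by (intro bexI[of _ 1]) auto
next
  case (diff u v)
  then obtain f g where "f \<in> lower_alg Z W (insert t T)" "deg_ge t 0 f" "comp_deg t 0 f = u"
    "g \<in> lower_alg Z W (insert t T)" "deg_ge t 0 g" "comp_deg t 0 g = v" by auto
  then show ?case using subring_diff[OF is_subring_lower_alg, of f Z W "insert t T" g]
    by (intro bexI[of _ "f - g"]) (auto intro: deg_ge_diff simp: comp_deg_diff)
next
  case (mult u v)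
  then obtain f g where "f \<in> lower_alg Z W (insert t T)" "deg_ge t 0 f" "comp_deg t 0 f = u"
    "g \<in> lower_alg Z W (insert t T)" "deg_ge t 0 g" "comp_deg t 0 g = v" by auto
  then show ?case using subring_mult[OF is_subring_lower_alg, of f Z W "insert t T" g]
      deg_ge_mult[of t 0 f 0 g] comp_deg_mult_lowest[of t 0 f 0 g]
    by (intro bexI[of _ "f * g"]) auto
next
  case (base y)
  have tN: "t \<in> N" "t \<notin> W" using st by (auto simp: stage_def)
  consider i where "y = var i" "i \<in> V - N \<union> (W \<union> T)"
    | i where "y = var_inv i" "i \<in> V - N"
    | j where "y = exchanged (insert t Z) j" "j \<in> T"
    using base by blast
  then show ?case
  proof cases
    case 1
    have "i \<noteq> t" using 1 tN st(2) by auto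
    then have "homog t 0 y" using 1 homog_var[of t i] by simp
    moreover have "y \<in> lower_alg Z W (insert t T)"
      using 1 unfolding lower_alg_def by (auto intro!: subring_gen.base)
    ultimately show ?thesis using homog_imp_deg_ge comp_deg_homog by (intro bexI[of _ y]) auto
  next
    case 2
    have "i \<noteq> t" using 2 tN by auto
    then have "homog t 0 y" using 2 homog_var_inv[of t i] by simp
    moreover have "y \<in> lower_alg Z W (insert t T)"
      using 2 unfolding lower_alg_def by (auto intro!: subring_gen.base)
    ultimately show ?thesis using homog_imp_deg_ge comp_deg_homog by (intro bexI[of _ y]) auto
  next
    case 3
    then have jt: "j \<in> N" "j \<noteq> t" using st by (auto simp: stage_def)
    have "homog t 0 (var_inv j)" using homog_var_inv[of t j] jt by simp
    then have "comp_deg t 0 (exchanged Z j) = y"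
      unfolding exchanged_def 3 specialize_insert using comp_deg_mult_homog[of t 0 "var_inv j" 0] by simp
    moreover have "exchanged Z j \<in> lower_alg Z W (insert t T)"
      unfolding lower_alg_def using 3 by (auto intro: subring_gen.base)
    moreover have "deg_ge t 0 (exchanged Z j)" using deg_ge_exchanged[OF jt(1)] jt(2) by auto
    ultimately show ?thesis by (intro bexI[of _ "exchanged Z j"]) auto
  qed
qed

text \<open>Once nothing is left to eliminate, only frozen variables can have negative exponents, so every
  monomial is a product of generators.\<close>
lemma laurent_monomial_in_lower_alg:
  assumes "y \<in> upper_alg Z W {}" and st: "stage Z W {}"
  shows "y \<in> lower_alg Z W {}"
proof -
  note R = is_subring_lower_alg[of Z W "{}"]
  have "Poly_Mapping.keys y \<subseteq> {e. (\<forall>i. i \<notin> V - Z \<longrightarrow> Poly_Mapping.lookup e i = 0) \<and>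
      (\<forall>i\<in>W. 0 \<le> Poly_Mapping.lookup e i)}"
    using assms(1) by (auto simp: upper_alg_def laurent_ring_def homog_def deg_ge_def)
  then show ?thesis
  proof (induction rule: monomial_induct)
    case zero
    show ?case by (rule subring_zero[OF R])
  next
    case (add u v)
    then show ?case by (rule subring_add[OF R])
  next
    case (single e c)
    have factor: "Poly_Mapping.single (Poly_Mapping.single i (Poly_Mapping.lookup e i)) 1 \<in> lower_alg Z W {}"
      if i: "i \<in> V - Z" for i
    proof (cases "Poly_Mapping.lookup e i \<ge> 0")
      case True
      have "var i \<in> lower_alg Z W {}"
        using i st N_subset unfolding lower_alg_def stage_def by (auto intro: subring_gen.base)
      then have "var i ^ nat (Poly_Mapping.lookup e i) \<in> lower_alg Z W {}"
        by (rule subring_power[OF R])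
      then show ?thesis using True by (simp add: var_power)
    next
      case False
      then have "i \<in> V - N" using i single st by (auto simp: stage_def)
      then have "var_inv i \<in> lower_alg Z W {}"
        unfolding lower_alg_def by (auto intro: subring_gen.base)
      then have "var_inv i ^ nat (- Poly_Mapping.lookup e i) \<in> lower_alg Z W {}"
        by (rule subring_power[OF R])
      then show ?thesis using False by (simp add: var_inv_power)
    qed
    have "Poly_Mapping.single (\<Sum>i\<in>I. Poly_Mapping.single i (Poly_Mapping.lookup e i)) 1 \<in> lower_alg Z W {}"
      if "I \<subseteq> V - Z" "finite I" for I
      using that(2,1)
    proof (induction I rule: finite_induct)
      case empty
      then show ?case using subring_one[OF R] by simp
    next
      case (insert i I)
      then have "Poly_Mapping.single (Poly_Mapping.single i (Poly_Mapping.lookup e i)) 1 *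
          Poly_Mapping.single (\<Sum>i\<in>I. Poly_Mapping.single i (Poly_Mapping.lookup e i)) 1 \<in> lower_alg Z W {}"
        using factor[of i] by (intro subring_mult[OF R]) auto
      then show ?case using insert.hyps by (simp add: mult_single)
    qed
    moreover have "Poly_Mapping.keys e \<subseteq> V - Z"
      using single by (auto simp: in_keys_iff)
    ultimately have "Poly_Mapping.single e 1 \<in> lower_alg Z W {}"
      using poly_mapping_sum_single[of e] finite_keys[of e] by metis
    moreover have "of_int c \<in> lower_alg Z W {}" by (rule subring_of_int[OF R])
    ultimately have "of_int c * Poly_Mapping.single e 1 \<in> lower_alg Z W {}"
      by (intro subring_mult[OF R])
    moreover have "(of_int c :: laurent) = Poly_Mapping.single 0 c"
      using single_of_int[of c, where ?'b = int and ?'a = "nat \<Rightarrow>\<^sub>0 int"]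
      unfolding of_int_eq_id id_apply by (rule sym)
    then have "of_int c * Poly_Mapping.single e 1 = Poly_Mapping.single e c"
      by (simp add: mult_single)
    ultimately show ?case by simp
  qed
qed

text \<open>The part \<open>c\<close> of degree \<open>- k\<close> in \<open>x\<^sub>t\<close> is divisible by \<open>P\<^sub>t ^ k\<close>. Its quotient by \<open>x'\<^sub>t ^ k\<close> has
  degree 0 in \<open>x\<^sub>t\<close>, and it stays in the upper algebra in which \<open>x\<^sub>t\<close> is set to 0. For the
  condition at \<open>j \<in> T\<close> there are two cases. If there is an edge from \<open>t\<close> to \<open>j\<close>, then \<open>P\<^sub>j\<close>
  specialises to a unit. Otherwise, \<open>x'\<^sub>t\<close> does not involve \<open>x\<^sub>j\<close>, so parts of fixed degree in
  \<open>x\<^sub>j\<close> can be taken through the product, and \<open>P\<^sub>t ^ k\<close> is cancelled by coprimality. The condition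
  for \<open>y\<close> passes to \<open>c\<close> because parts with respect to \<open>x\<^sub>j\<close> and \<open>x\<^sub>t\<close> can be taken in either
  order.\<close>
lemma lowest_quotient_in_upper_alg:
  assumes st: "stage Z W (insert t T)" "t \<notin> T" and source: "\<forall>j\<in>T. b t j \<ge> 0"
    and y: "y \<in> upper_alg Z W (insert t T)"
  obtains e where "e \<in> upper_alg (insert t Z) W T"
    "comp_deg t (- int k) y = exchanged Z t ^ k * e"
proof -
  have tN: "t \<in> N" "Z \<subseteq> N" and Zt: "\<forall>i\<in>Z. b i t \<ge> 0"
    using st by (auto simp: stage_def)
  have specialize_t: "specialize Z t \<noteq> 0" by (rule specialize_nonzero[OF tN Zt])
  define c where "c = comp_deg t (- int k) y"
  have "specialize Z t ^ nat (0 - (- int k)) dvd c"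
    using y unfolding upper_alg_def div_cond_def c_def by blast
  then obtain q where q: "c = specialize Z t ^ k * q" by (auto simp: dvd_def)
  define e where "e = var t ^ k * q"
  have "var_inv t ^ k * var t ^ k = 1"
    by (simp add: var_var_inv mult.commute flip: power_mult_distrib)
  then have c: "c = exchanged Z t ^ k * e"
    unfolding q e_def exchanged_def power_mult_distrib by (simp add: mult_ac)
  have specialize_k: "specialize Z t ^ k \<noteq> 0" using specialize_t by simp
  have nv0: "exchanged Z t \<noteq> 0"
    using specialize_t var_var_inv[of t] unfolding exchanged_def by (metis mult_eq_0_iff mult_zero_right zero_neq_one)
  have homog_c: "homog t (- int k) c" by (simp add: c_def homog_comp_deg)
  have homog_e: "homog i 0 e" if "i \<noteq> t" "homog i 0 (specialize Z t)" "homog i 0 y" for i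
  proof -
    have "homog i 0 (exchanged Z t)"
      unfolding exchanged_def using homog_mult[OF homog_var_inv[of i t] that(2)] that(1) by simp
    then have "homog i 0 (exchanged Z t ^ k)" by (rule homog_power0)
    moreover have "homog i 0 c" unfolding c_def by (rule homog_comp_deg_other[OF that(3)])
    then have "homog i 0 (e * exchanged Z t ^ k)" unfolding c by (simp only: mult.commute)
    moreover have "exchanged Z t ^ k \<noteq> 0" using nv0 by simp
    ultimately show ?thesis using homog_quotient by blast
  qed
  have e_t: "homog t 0 e"
  proof -
    have "homog t 0 (specialize Z t ^ k)"
      using homog_power0 homog_specialize[OF P_homog[of t t]] tN b_diag by simp
    then have "homog t (- int k) q"
      using homog_quotient[of t "specialize Z t ^ k" "- int k" q] homog_c q specialize_k by (simp add: mult.commute)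
    then show ?thesis
      using homog_mult[OF homog_power[OF homog_var[of t t], of k]] by (fastforce simp: e_def)
  qed
  have "e \<in> laurent_ring (V - insert t Z)"
    unfolding laurent_ring_def
  proof (intro CollectI allI impI)
    fix i assume i: "i \<notin> V - insert t Z"
    show "homog i 0 e"
    proof (cases "i = t")
      case True
      then show ?thesis using e_t by simp
    next
      case False
      then have "i \<notin> V - Z" using i by simp
      then show ?thesis
        using homog_e[OF False] y specialize_laurent_ring[OF tN(1), of Z]
        by (auto simp: upper_alg_def laurent_ring_def)
    qed
  qed
  moreover have "deg_ge i 0 e" if i: "i \<in> W" for i
  proof -
    have it: "i \<noteq> t" "i \<in> N" "b i t \<ge> 0" using i st by (auto simp: stage_def)
    have hv: "homog i 0 (var_inv t)" using homog_var_inv[of i t] it by simp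
    have "comp_deg i 0 (exchanged Z t) = var_inv t * specialize (insert i Z) t"
      unfolding exchanged_def specialize_insert using comp_deg_mult_homog[OF hv] by simp
    then have "comp_deg i 0 (exchanged Z t) \<noteq> 0"
      using specialize_nonzero[OF tN(1), of "insert i Z"] it tN Zt nv0 by (auto simp: exchanged_def)
    moreover have "deg_ge i 0 (exchanged Z t ^ l) \<and>
        comp_deg i 0 (exchanged Z t ^ l) = comp_deg i 0 (exchanged Z t) ^ l" for l
    proof (induction l)
      case 0
      show ?case using homog_imp_deg_ge[OF homog_one] comp_deg_homog[OF homog_one, of i 0] by simp
    next
      case (Suc l)
      have "deg_ge i 0 (exchanged Z t)" using deg_ge_exchanged[OF tN(1) it(1)] .
      then show ?case using Suc deg_ge_mult[of i 0 "exchanged Z t" 0 "exchanged Z t ^ l"]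
          comp_deg_mult_lowest[of i 0 "exchanged Z t" 0 "exchanged Z t ^ l"] by simp
    qed
    moreover have "deg_ge i 0 c"
      unfolding c_def using y i by (intro deg_ge_comp_deg) (auto simp: upper_alg_def)
    then have "deg_ge i 0 (e * exchanged Z t ^ k)" unfolding c by (simp only: mult.commute)
    ultimately show ?thesis using deg_ge_quotient[of i "exchanged Z t ^ k" 0 e] by simp
  qed
  moreover have eV: "e \<in> laurent_ring V"
    using calculation(1) by (auto simp: laurent_ring_def)
  moreover have "div_cond j (specialize (insert t Z) j) 0 e" if j: "j \<in> T" for j
  proof -
    have jN: "j \<in> N" "j \<noteq> t" and Zj: "\<forall>i\<in>insert t Z. b i j \<ge> 0"
      using st j source by (auto simp: stage_def)
    consider "b t j > 0" | "b t j = 0" using Zj by force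
    then show ?thesis
    proof cases
      case 1
      then show ?thesis using specialize_unit[OF jN(1) _ Zj, of t] tN div_cond_unit by simp
    next
      case 2
      have jt: "b j t = 0" using b_zero 2 tN jN by blast
      have hj: "homog t 0 (specialize Z j)" by (rule homog_specialize[OF P_homog[OF tN(1) jN(1) 2]])
      then have specialize_j: "specialize (insert t Z) j = specialize Z j"
        by (simp add: specialize_insert comp_deg_homog)
      have nvt: "homog j 0 (exchanged Z t ^ k)"
        using homog_exchanged_other[OF jN(1) tN(1) jt jN(2)] by (rule homog_power0)
      show ?thesis
        unfolding div_cond_def specialize_j
      proof
        fix a
        let ?l = "nat (0 - a)"
        have "specialize Z j ^ ?l dvd comp_deg j a y"
          using y j unfolding upper_alg_def div_cond_def by blast
        then obtain r where r: "comp_deg j a y = specialize Z j ^ ?l * r" by (auto simp: dvd_def)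
        have "exchanged Z t ^ k * comp_deg j a e = comp_deg j a c"
          unfolding c using comp_deg_mult_homog[OF nvt] by simp
        also have "\<dots> = comp_deg t (- int k) (comp_deg j a y)"
          by (simp add: c_def comp_deg_commute)
        also have "\<dots> = specialize Z j ^ ?l * comp_deg t (- int k) r"
          unfolding r using comp_deg_mult_homog[OF homog_power0[OF hj]] by simp
        finally have eq: "exchanged Z t ^ k * comp_deg j a e = specialize Z j ^ ?l * comp_deg t (- int k) r" .
        have "specialize Z t ^ k * comp_deg j a e = var t ^ k * (exchanged Z t ^ k * comp_deg j a e)"
          using \<open>var_inv t ^ k * var t ^ k = 1\<close>
          unfolding exchanged_def power_mult_distrib by (simp add: mult_ac)
        then have "specialize Z j ^ ?l dvd specialize Z t ^ k * comp_deg j a e"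
          unfolding eq by simp
        moreover have "comp_deg j a e \<in> laurent_ring V"
          using eV homog_comp_deg_other by (auto simp: laurent_ring_def)
        moreover have "specialize Z j \<in> laurent_ring V" "specialize Z t \<in> laurent_ring V"
          using specialize_laurent_ring tN jN by (auto simp: laurent_ring_def)
        moreover have "specialize Z j \<noteq> 0" using specialize_nonzero[OF jN(1) tN(2)] Zj by simp
        moreover have "specialize Z j dvd g" if "g \<in> laurent_ring V" "specialize Z j dvd specialize Z t * g" for g
          using specialize_cancels[OF tN Zt jN(1) _ _ that] Zj jN by simp
        ultimately show "specialize Z j ^ ?l dvd comp_deg j a e"
          using cancels_powers[of "specialize Z j" V "specialize Z t"] by blast
      qed
    qed
  qed
  ultimately have "e \<in> upper_alg (insert t Z) W T" unfolding upper_alg_def by blast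
  then show thesis using that c unfolding c_def by blast
qed

text \<open>The elimination. Outer induction on the number of variables left; the next one, \<open>t\<close>, is a source
  of the remaining graph. Inner induction on a bound \<open>k\<close> for the negative powers of \<open>x\<^sub>t\<close>. For
  \<open>k = 0\<close>, the variable \<open>x\<^sub>t\<close> joins \<open>W\<close>. Otherwise the part of lowest degree is \<open>x'\<^sub>t ^ k * e\<close>,
  the outer induction hypothesis with \<open>x\<^sub>t = 0\<close> applies to \<open>e\<close>, and subtracting \<open>x'\<^sub>t ^ k\<close> times a
  lift of \<open>e\<close> decreases the bound.\<close>
theorem upper_alg_subset_lower_alg:
  assumes "finite T" "stage Z W T" "y \<in> upper_alg Z W T"
  shows "y \<in> lower_alg Z W T"
  using assms
proof (induction "card T" arbitrary: T Z W y)
  case 0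
  then show ?case using laurent_monomial_in_lower_alg by simp
next
  case (Suc n)
  have IH: "upper_alg Z W T \<subseteq> lower_alg Z W T" if "card T = n" "finite T" "stage Z W T" for Z W T
    using Suc.hyps(1)[of T Z W] that by blast
  have T_N: "T \<subseteq> N" using Suc.prems by (auto simp: stage_def)
  have T_ne: "T \<noteq> {}" using Suc.hyps by auto
  have wf: "wf {(i, j). i \<in> N \<and> j \<in> N \<and> b i j > 0}"
  proof (rule finite_acyclic_wf[OF _ acyclic_b])
    have "finite N" using finite_V N_subset finite_subset by blast
    then have "finite (N \<times> N)" by simp
    then show "finite {(i, j). i \<in> N \<and> j \<in> N \<and> b i j > 0}"
      by (rule rev_finite_subset) auto
  qed
  obtain t where t: "t \<in> T"
    and "\<And>i. (i, t) \<in> {(i, j). i \<in> N \<and> j \<in> N \<and> b i j > 0} \<Longrightarrow> i \<notin> T"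
    by (rule wfE_min'[OF wf T_ne]) blast
  then have min: "\<forall>i. i \<in> N \<and> t \<in> N \<and> b i t > 0 \<longrightarrow> i \<notin> T" by simp
  define T' where "T' = T - {t}"
  have T': "T = insert t T'" "t \<notin> T'" "finite T'" "card T' = n"
    using t Suc by (auto simp: T'_def)
  have source: "\<forall>j\<in>T'. b t j \<ge> 0"
  proof
    fix j assume j: "j \<in> T'"
    then have "\<not> b j t > 0" using min T_N t T' by auto
    then show "b t j \<ge> 0" using b_sign[of j t] T_N t T' j by auto
  qed
  have st: "stage Z W (insert t T')" using Suc.prems T' by simp
  note R = is_subring_lower_alg[of Z W T]
  have tN: "t \<in> N" using T_N t by blast
  note stT = Suc.prems(2)
  have "y \<in> lower_alg Z W T" if "y \<in> upper_alg Z W T" "deg_ge t (- int k) y" for k y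
    using that
  proof (induction k arbitrary: y)
    case 0
    have "y \<in> upper_alg Z (insert t W) T'"
      using 0 T' by (auto simp: upper_alg_def)
    then have "y \<in> lower_alg Z (insert t W) T'"
      using IH[OF T'(4,3) stage_poly[OF st T'(2) source]] by blast
    moreover have "lower_alg Z (insert t W) T' \<subseteq> lower_alg Z W T"
      unfolding lower_alg_def T'(1) by (rule subring_gen_mono) (auto intro: subring_gen.base)
    ultimately show ?case by blast
  next
    case (Suc k)
    have y: "y \<in> upper_alg Z W (insert t T')" using Suc.prems T' by simp
    obtain e where e: "e \<in> upper_alg (insert t Z) W T'"
      "comp_deg t (- int (Suc k)) y = exchanged Z t ^ Suc k * e"
      using lowest_quotient_in_upper_alg[OF st T'(2) source y] by metis
    have "e \<in> lower_alg (insert t Z) W T'"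
      using IH[OF T'(4,3) stage_zero[OF st T'(2) source]] e(1) by blast
    then obtain f where f: "f \<in> lower_alg Z W T" "deg_ge t 0 f" "comp_deg t 0 f = e"
      using lift_from_zero[OF st T'(2)] T'(1) by metis
    let ?x = "exchanged Z t ^ Suc k"
    have "exchanged Z t \<in> lower_alg Z W T"
      unfolding lower_alg_def using t by (auto intro: subring_gen.base)
    then have xf: "?x * f \<in> lower_alg Z W T"
      using subring_mult[OF R subring_power[OF R] f(1)] by blast
    have hx: "homog t (- int (Suc k)) ?x"
      using homog_power[OF homog_exchanged[OF tN], of "Suc k" Z] by simp
    have ge: "deg_ge t (- int (Suc k)) (y - ?x * f)"
      using deg_ge_diff[OF Suc.prems(2)] deg_ge_mult[OF homog_imp_deg_ge[OF hx] f(2)] by simp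
    have "comp_deg t (- int (Suc k)) (?x * f) = ?x * e"
      using comp_deg_mult_homog[OF hx, of "- int (Suc k)" f] f(3) by simp
    then have "comp_deg t (- int (Suc k)) (y - ?x * f) = 0"
      using e(2) by (simp add: comp_deg_diff)
    then have no: "a \<in> Poly_Mapping.keys (y - ?x * f) \<Longrightarrow> Poly_Mapping.lookup a t \<noteq> - int (Suc k)" for a
      using keys_comp_deg[of t "- int (Suc k)" "y - ?x * f"] by auto
    have "deg_ge t (- int k) (y - ?x * f)"
      unfolding deg_ge_def
    proof
      fix a assume a: "a \<in> Poly_Mapping.keys (y - ?x * f)"
      then have "- int (Suc k) \<le> Poly_Mapping.lookup a t" using ge unfolding deg_ge_def by blast
      then show "- int k \<le> Poly_Mapping.lookup a t" using no[OF a] by linarith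
    qed
    moreover have "y - ?x * f \<in> upper_alg Z W T"
      using xf lower_alg_subset_upper_alg[OF stT] Suc.prems(1)
        subring_diff[OF is_subring_upper_alg] by blast
    ultimately have "y - ?x * f \<in> lower_alg Z W T" by (intro Suc.IH)
    then have "(y - ?x * f) + ?x * f \<in> lower_alg Z W T" by (rule subring_add[OF R _ xf])
    then show ?case by (simp only: diff_add_cancel)
  qed
  moreover obtain k where "deg_ge t (- int k) y"
  proof -
    define C where "C = Max (insert 0 ((\<lambda>e. - Poly_Mapping.lookup e t) ` Poly_Mapping.keys y))"
    have "- C \<le> Poly_Mapping.lookup e t" if "e \<in> Poly_Mapping.keys y" for e
    proof -
      have "- Poly_Mapping.lookup e t \<le> C"
        unfolding C_def using that by (intro Max_ge) auto
      then show ?thesis by simp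
    qed
    moreover have "0 \<le> C" unfolding C_def by (intro Max_ge) auto
    ultimately have "deg_ge t (- int (nat C)) y" by (simp add: deg_ge_def)
    then show thesis using that by blast
  qed
  ultimately show ?case using Suc.prems by blast
qed

end

section \<open>Evaluation at the extended cluster\<close>

lemma homog_sum: "(\<And>i. i \<in> I \<Longrightarrow> homog j a (f i)) \<Longrightarrow> homog j a (sum f I)"
  using keys_sum[of f I] by (force simp: homog_def)

lemma lookup_sum_single:
  assumes "finite V"
  shows "Poly_Mapping.lookup (\<Sum>i\<in>V. Poly_Mapping.single i (f i)) j = (if j \<in> V then f j else (0::int))"
proof -
  have "Poly_Mapping.lookup (\<Sum>i\<in>V. Poly_Mapping.single i (f i)) j = (\<Sum>i\<in>V. if i = j then f i else 0)"
    unfolding lookup_sum by (rule sum.cong) (auto simp: lookup_single when_def)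
  then show ?thesis using assms by simp
qed

lemma ZP_adjoin_subset:
  assumes B: "is_subring B" and "coeff_group m n x \<subseteq> B" "S \<subseteq> B"
  shows "ZP_adjoin m n x S \<subseteq> B"
proof -
  have gen: "subring_gen G \<subseteq> B" if "G \<subseteq> B" for G
  proof
    fix y assume "y \<in> subring_gen G"
    then show "y \<in> B"
      by induction (use that subring_one[OF B] subring_diff[OF B] subring_mult[OF B] in auto)
  qed
  show ?thesis
    unfolding ZP_adjoin_def ZP_def using assms by (intro gen Un_least)
qed

lemma is_subring_ZP_adjoin: "is_subring (ZP_adjoin m n x S)"
  by (auto simp: is_subring_def ZP_adjoin_def intro: subring_gen.intros)

lemma coeff_group_in_ZP_adjoin: "coeff_group m n x \<subseteq> ZP_adjoin m n x S"
  by (auto simp: ZP_adjoin_def ZP_def intro: subring_gen.base)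

lemma ZP_adjoin_gen: "s \<in> S \<Longrightarrow> s \<in> ZP_adjoin m n x S"
  by (auto simp: ZP_adjoin_def intro: subring_gen.base)

lemma frozen_in_ZP_adjoin:
  assumes "k \<in> {n+1..m}"
  shows "x k \<in> ZP_adjoin m n x S" "inverse (x k) \<in> ZP_adjoin m n x S"
proof -
  have "(\<Prod>i\<in>{n+1..m}. x i powi (if i = k then a else 0)) = x k powi a" for a
  proof -
    have "(\<Prod>i\<in>{n+1..m}. x i powi (if i = k then a else 0)) =
        (\<Prod>i\<in>{n+1..m}. if i = k then x i powi a else 1)"
      by (rule prod.cong) auto
    then show ?thesis using assms by simp
  qed
  then have "x k powi a \<in> coeff_group m n x" for a
    unfolding coeff_group_def by (intro CollectI exI[of _ "\<lambda>i. if i = k then a else 0"]) simp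
  from this[of 1] this[of "-1"] show "x k \<in> ZP_adjoin m n x S" "inverse (x k) \<in> ZP_adjoin m n x S"
    using coeff_group_in_ZP_adjoin[of m n x S] by auto
qed

context generalized_seed
begin

lemma x_nonzero:
  assumes "i \<in> {1..m}"
  shows "x i \<noteq> 0"
proof
  assume "x i = 0"
  let ?p = "Poly_Mapping.single (Poly_Mapping.single i (1::nat)) (1::rat)"
  have "poly_eval x ?p = 0" using \<open>x i = 0\<close> by (simp add: poly_eval_def)
  moreover have "\<forall>e\<in>Poly_Mapping.keys ?p. Poly_Mapping.keys e \<subseteq> {1..m}"
    using assms by auto
  ultimately have "?p = 0"
    using independent[unfolded algebraically_independent_def, rule_format, of ?p] by blast
  then show False by (metis lookup_single_eq lookup_zero zero_neq_one)
qed

definition mon :: "(nat \<Rightarrow>\<^sub>0 int) \<Rightarrow> 'a" where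
  "mon e = (\<Prod>i\<in>{1..m}. x i powi Poly_Mapping.lookup e i)"

definition ev :: "laurent \<Rightarrow> 'a" where
  "ev y = (\<Sum>e\<in>Poly_Mapping.keys y. of_int (Poly_Mapping.lookup y e) * mon e)"

lemma mon_add: "mon (e + e') = mon e * mon e'"
  using x_nonzero by (simp add: mon_def lookup_add power_int_add prod.distrib)

lemma mon_zero: "mon 0 = 1"
  by (simp add: mon_def)

lemma ev_superset:
  assumes "finite A" "Poly_Mapping.keys y \<subseteq> A"
  shows "ev y = (\<Sum>e\<in>A. of_int (Poly_Mapping.lookup y e) * mon e)"
  unfolding ev_def using assms by (intro sum.mono_neutral_left) (auto simp: in_keys_iff)

lemma ev_single: "ev (Poly_Mapping.single e c) = of_int c * mon e"
  using ev_superset[of "{e}" "Poly_Mapping.single e c"] by simp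

lemma ev_add: "ev (u + v) = ev u + ev v"
proof -
  let ?A = "Poly_Mapping.keys u \<union> Poly_Mapping.keys v"
  have "ev (u + v) = (\<Sum>e\<in>?A. of_int (Poly_Mapping.lookup (u + v) e) * mon e)"
    using keys_add[of u v] by (intro ev_superset) auto
  also have "\<dots> = (\<Sum>e\<in>?A. of_int (Poly_Mapping.lookup u e) * mon e)
      + (\<Sum>e\<in>?A. of_int (Poly_Mapping.lookup v e) * mon e)"
    by (simp add: lookup_add algebra_simps sum.distrib)
  also have "\<dots> = ev u + ev v"
    using ev_superset[of ?A u] ev_superset[of ?A v] by simp
  finally show ?thesis .
qed

lemma ev_diff: "ev (u - v) = ev u - ev v"
  using ev_add[of "u - v" v] by (simp add: algebra_simps)

lemma ev_zero: "ev 0 = 0"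
  by (simp add: ev_def)

lemma ev_one: "ev 1 = 1"
  using ev_single[of 0 1] by (simp add: mon_zero)

lemma ev_mult: "ev (u * v) = ev u * ev v"
proof -
  have single: "ev (Poly_Mapping.single e c * v) = of_int c * mon e * ev v" for e c
  proof -
    have "Poly_Mapping.keys v \<subseteq> UNIV" by simp
    then show ?thesis
    proof (induction v rule: monomial_induct)
      case zero
      show ?case by (simp add: ev_zero)
    next
      case (single e' c')
      show ?case by (simp add: mult_single ev_single mon_add)
    next
      case (add u w)
      then show ?case by (simp add: distrib_left ev_add)
    qed
  qed
  have "Poly_Mapping.keys u \<subseteq> UNIV" by simp
  then show ?thesis
    by (induction u rule: monomial_induct) (simp_all add: ev_zero single ev_single distrib_right ev_add)
qed

lemma ev_sum: "ev (sum f I) = (\<Sum>i\<in>I. ev (f i))"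
  by (induction I rule: infinite_finite_induct) (auto simp: ev_zero ev_add)

lemma ev_power: "ev (u ^ k) = ev u ^ k"
  by (induction k) (auto simp: ev_one ev_mult)

lemma mon_single: "i \<in> {1..m} \<Longrightarrow> mon (Poly_Mapping.single i a) = x i powi a"
proof -
  assume i: "i \<in> {1..m}"
  have "mon (Poly_Mapping.single i a) = (\<Prod>j\<in>{1..m}. if j = i then x j powi a else 1)"
    unfolding mon_def by (rule prod.cong) (auto simp: lookup_single when_def)
  then show ?thesis using i by simp
qed

lemma ev_var: "i \<in> {1..m} \<Longrightarrow> ev (var i) = x i"
  using mon_single[of i 1] by (simp add: var_def ev_single)

lemma ev_var_inv: "i \<in> {1..m} \<Longrightarrow> ev (var_inv i) = inverse (x i)"
  using mon_single[of i "-1"] by (simp add: var_inv_def ev_single)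

text \<open>Algebraic independence is stated for polynomials with natural exponents and rational
  coefficients, so \<open>y\<close> is first transported to such a polynomial.\<close>
lemma ev_poly_ring_eq_0:
  assumes y: "y \<in> poly_ring {1..m}" and ev0: "ev y = 0"
  shows "y = 0"
proof -
  define f :: "(nat \<Rightarrow>\<^sub>0 nat) \<Rightarrow> (nat \<Rightarrow>\<^sub>0 int)" where "f = Poly_Mapping.map int"
  have lf: "Poly_Mapping.lookup (f e) i = int (Poly_Mapping.lookup e i)" for e i
    by (simp add: f_def Poly_Mapping.map.rep_eq when_def)
  have inj: "inj f"
    by (rule injI) (metis lf of_nat_eq_iff poly_mapping_eqI)
  have y_keys: "Poly_Mapping.lookup e i \<ge> 0" "i \<notin> {1..m} \<Longrightarrow> Poly_Mapping.lookup e i = 0"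
    if "e \<in> Poly_Mapping.keys y" for e i
    using y that by (auto simp: poly_ring_def laurent_ring_def homog_def deg_ge_def)
  have surj: "e \<in> range f" if e: "e \<in> Poly_Mapping.keys y" for e
  proof -
    have "e = f (Poly_Mapping.map nat e)"
    proof (rule poly_mapping_eqI)
      fix i
      show "Poly_Mapping.lookup e i = Poly_Mapping.lookup (f (Poly_Mapping.map nat e)) i"
        using y_keys(1)[OF e, of i] by (simp add: lf Poly_Mapping.map.rep_eq when_def)
    qed
    then show ?thesis by blast
  qed
  define p where "p = Poly_Mapping.map rat_of_int (Poly_Mapping.map_key f y)"
  have lp: "Poly_Mapping.lookup p e = of_int (Poly_Mapping.lookup y (f e))" for e
    by (simp add: p_def Poly_Mapping.map.rep_eq when_def map_key.rep_eq[OF inj])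
  have kp: "e \<in> Poly_Mapping.keys p \<longleftrightarrow> f e \<in> Poly_Mapping.keys y" for e
    by (simp add: in_keys_iff lp)
  have img: "f ` Poly_Mapping.keys p = Poly_Mapping.keys y"
    using kp surj by blast
  have sub: "Poly_Mapping.keys e \<subseteq> {1..m}" if "e \<in> Poly_Mapping.keys p" for e
    using y_keys(2)[of "f e"] that kp by (force simp: in_keys_iff lf)
  have "poly_eval x p = (\<Sum>e\<in>Poly_Mapping.keys p. of_int (Poly_Mapping.lookup y (f e)) * mon (f e))"
    unfolding poly_eval_def
  proof (rule sum.cong)
    fix e assume e: "e \<in> Poly_Mapping.keys p"
    have "(\<Prod>i\<in>Poly_Mapping.keys e. x i ^ Poly_Mapping.lookup e i) =
        (\<Prod>i\<in>{1..m}. x i ^ Poly_Mapping.lookup e i)"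
      using sub[OF e] by (intro prod.mono_neutral_left) (auto simp: in_keys_iff)
    then show "of_rat (Poly_Mapping.lookup p e) * (\<Prod>i\<in>Poly_Mapping.keys e. x i ^ Poly_Mapping.lookup e i)
        = of_int (Poly_Mapping.lookup y (f e)) * mon (f e)"
      by (simp add: lp mon_def lf)
  qed simp
  also have "\<dots> = ev y"
    unfolding ev_def img[symmetric] using inj
    by (subst sum.reindex) (auto intro: inj_on_subset)
  finally have "p = 0"
    using independent sub ev0 unfolding algebraically_independent_def by auto
  then have "Poly_Mapping.keys y = {}" using img by simp
  then show ?thesis by simp
qed

lemma ev_inj:
  assumes "u \<in> laurent_ring {1..m}" "v \<in> laurent_ring {1..m}" "ev u = ev v"
  shows "u = v"
proof -
  have "u - v \<in> laurent_ring {1..m}"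
    using assms subring_diff[OF is_subring_laurent_ring] by blast
  then obtain M where M: "Poly_Mapping.single M 1 * (u - v) \<in> poly_ring {1..m}"
    using laurent_denominator by blast
  have "ev (Poly_Mapping.single M 1 * (u - v)) = 0" using assms by (simp add: ev_mult ev_diff)
  then have "Poly_Mapping.single M 1 * (u - v) = 0" using ev_poly_ring_eq_0 M by blast
  then have "Poly_Mapping.single (- M) 1 * Poly_Mapping.single M 1 * (u - v) = 0"
    by (simp add: mult.assoc)
  then show ?thesis using single_unit[of M] by (simp add: mult.commute)
qed

lemma is_subring_ev_image: "is_subring A \<Longrightarrow> is_subring (ev ` A)"
  unfolding is_subring_def by (auto simp: ev_diff[symmetric] ev_mult[symmetric] intro!: image_eqI[of 1 ev] simp: ev_one)

lemma coeff_group_ev: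
  assumes "z \<in> coeff_group m n x"
  obtains e where "z = ev (Poly_Mapping.single e 1)" "\<forall>i. i \<notin> {n+1..m} \<longrightarrow> Poly_Mapping.lookup e i = 0"
proof -
  obtain a where z: "z = (\<Prod>k\<in>{n+1..m}. x k powi a k)"
    using assms by (auto simp: coeff_group_def)
  define e where "e = (\<Sum>k\<in>{n+1..m}. Poly_Mapping.single k (a k))"
  have le: "Poly_Mapping.lookup e i = (if i \<in> {n+1..m} then a i else 0)" for i
    unfolding e_def by (rule lookup_sum_single) simp
  have "mon e = (\<Prod>k\<in>{1..m}. if k \<in> {n+1..m} then x k powi a k else 1)"
    unfolding mon_def le by (rule prod.cong) auto
  also have "\<dots> = z"
    unfolding z by (subst prod.inter_restrict[symmetric]) (auto intro: prod.cong)
  finally have "z = ev (Poly_Mapping.single e 1)" by (simp add: ev_single)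
  then show thesis using that le by simp
qed

lemma ZP_adjoin_laurent:
  assumes "S \<subseteq> ev ` laurent_ring {1..m}"
  shows "ZP_adjoin m n x S \<subseteq> ev ` laurent_ring {1..m}"
proof (rule ZP_adjoin_subset)
  show "is_subring (ev ` laurent_ring {1..m})"
    by (intro is_subring_ev_image is_subring_laurent_ring)
  show "coeff_group m n x \<subseteq> ev ` laurent_ring {1..m}"
  proof
    fix z assume "z \<in> coeff_group m n x"
    then obtain e where "z = ev (Poly_Mapping.single e 1)"
      "\<forall>i. i \<notin> {n+1..m} \<longrightarrow> Poly_Mapping.lookup e i = 0"
      by (rule coeff_group_ev)
    moreover from this have "Poly_Mapping.single e 1 \<in> laurent_ring {1..m}"
      by (auto simp: laurent_ring_def homog_def)
    ultimately show "z \<in> ev ` laurent_ring {1..m}" by blast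
  qed
qed (rule assms)

lemma ev_poly_ring_in_ZP_adjoin:
  assumes "y \<in> poly_ring {1..m}"
  shows "ev y \<in> ZP_adjoin m n x (x ` {1..n})"
proof -
  note R = is_subring_ZP_adjoin[of m n x "x ` {1..n}"]
  have "Poly_Mapping.keys y \<subseteq> {e. \<forall>i. 0 \<le> Poly_Mapping.lookup e i}"
    using assms by (auto simp: poly_ring_def deg_ge_def)
  then show ?thesis
  proof (induction rule: monomial_induct)
    case zero
    show ?case using subring_zero[OF R] by (simp add: ev_zero)
  next
    case (add u v)
    then show ?case using subring_add[OF R] by (simp add: ev_add)
  next
    case (single e c)
    have xR: "x i \<in> ZP_adjoin m n x (x ` {1..n})" if "i \<in> {1..m}" for i
      using that by (cases "i \<le> n") (auto intro: ZP_adjoin_gen frozen_in_ZP_adjoin)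
    have "mon e = (\<Prod>i\<in>{1..m}. x i ^ nat (Poly_Mapping.lookup e i))"
      unfolding mon_def using single by (intro prod.cong) (auto simp: power_int_def)
    also have "\<dots> \<in> ZP_adjoin m n x (x ` {1..n})"
      by (intro subring_prod[OF R] subring_power[OF R] xR)
    finally show ?case unfolding ev_single by (intro subring_mult[OF R] subring_of_int[OF R])
  qed
qed

subsection \<open>Exchange polynomials as Laurent polynomials\<close>

text \<open>The coefficient and the exponents of each \<open>\<rho>\<^sub>i\<^sub>,\<^sub>r\<close>, chosen once and for all. The choice for \<open>r = 0\<close>
  is fixed because that term survives the specialisation.\<close>
lemma rho_data:
  "\<exists>c e. \<forall>i\<in>{1..n}. \<forall>r\<le>d i.
     \<rho> i r = of_int (c i r) * (\<Prod>k\<in>{n+1..m}. x k ^ e i r k) \<and>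
     (r = 0 \<longrightarrow> c i r = (1::int) \<and> e i r = (\<lambda>_. 0::nat))"
proof -
  define Q where "Q i r ce \<longleftrightarrow>
     (i \<in> {1..n} \<and> r \<le> d i \<longrightarrow> \<rho> i r = of_int (fst ce) * (\<Prod>k\<in>{n+1..m}. x k ^ snd ce k) \<and>
       (r = 0 \<longrightarrow> fst ce = (1::int) \<and> snd ce = (\<lambda>_. 0::nat)))" for i r ce
  have "\<exists>ce. Q i r ce" for i r
  proof (cases "r = 0 \<or> r = d i")
    case True
    then show ?thesis
      using rho_first[of i] rho_last[of i] by (intro exI[of _ "(1, \<lambda>_. 0)"]) (auto simp: Q_def)
  next
    case False
    show ?thesis
    proof (cases "i \<in> {1..n} \<and> r \<le> d i")
      case True
      then have "i \<in> {1..n}" "r \<in> {1..d i - 1}" using False by auto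
      then obtain c e where "\<rho> i r = of_int c * (\<Prod>k\<in>{n+1..m}. x k ^ e k)"
        using rho_monomial by blast
      then show ?thesis using False by (intro exI[of _ "(c, e)"]) (auto simp: Q_def)
    qed (auto simp: Q_def)
  qed
  then obtain ce where ce: "\<And>i r. Q i r (ce i r)" by metis
  show ?thesis
    by (rule exI[of _ "\<lambda>i r. fst (ce i r)"], rule exI[of _ "\<lambda>i r. snd (ce i r)"]) (use ce in \<open>simp add: Q_def\<close>)
qed

lemma beta_sign:
  assumes "i \<in> {1..m}" "j \<in> {1..n}"
  shows "b i j = int (d j) * \<beta> d b i j"
    "\<beta> d b i j > 0 \<longleftrightarrow> b i j > 0" "\<beta> d b i j \<ge> 0 \<longleftrightarrow> b i j \<ge> 0" "\<beta> d b i j = 0 \<longleftrightarrow> b i j = 0"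
proof -
  show b: "b i j = int (d j) * \<beta> d b i j"
    using d_dvd[OF assms] by (simp add: \<beta>_def)
  show "\<beta> d b i j > 0 \<longleftrightarrow> b i j > 0" "\<beta> d b i j \<ge> 0 \<longleftrightarrow> b i j \<ge> 0" "\<beta> d b i j = 0 \<longleftrightarrow> b i j = 0"
    using d_pos[OF assms(2)] by (auto simp: b zero_less_mult_iff zero_le_mult_iff)
qed

lemma b_antisym:
  assumes "i \<in> {1..n}" "j \<in> {1..n}"
  shows "b i j > 0 \<longleftrightarrow> b j i < 0"
proof -
  obtain D :: "nat \<Rightarrow> int" where D: "D i > 0" "D j > 0" "D i * b i j = - (D j * b j i)"
    using skew_symmetrizable assms by blast
  have "b i j > 0 \<longleftrightarrow> D i * b i j > 0" using D(1) by (simp add: zero_less_mult_iff)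
  also have "\<dots> \<longleftrightarrow> D j * b j i < 0" using D(3) by linarith
  also have "\<dots> \<longleftrightarrow> b j i < 0" using D(2) by (simp add: mult_less_0_iff)
  finally show ?thesis .
qed

context
  fixes c :: "nat \<Rightarrow> nat \<Rightarrow> int" and e :: "nat \<Rightarrow> nat \<Rightarrow> nat \<Rightarrow> nat"
  assumes rho: "\<And>i r. i \<in> {1..n} \<Longrightarrow> r \<le> d i \<Longrightarrow>
      \<rho> i r = of_int (c i r) * (\<Prod>k\<in>{n+1..m}. x k ^ e i r k)"
    and c0: "\<And>i. i \<in> {1..n} \<Longrightarrow> c i 0 = 1" and e0: "\<And>i. i \<in> {1..n} \<Longrightarrow> e i 0 = (\<lambda>_. 0)"
    and x'_nonzero: "\<forall>k\<in>{1..n}. exchanged_var m x \<rho> d b k \<noteq> 0"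
    and coprime: "coprime_seed m n x \<rho> d b"
    and acyclic: "acyclic_seed n b"
begin

definition lift_exp :: "nat \<Rightarrow> nat \<Rightarrow> nat \<Rightarrow>\<^sub>0 int" where
  "lift_exp i r = (\<Sum>j\<in>{1..m}. Poly_Mapping.single j
     (int (r * nat (\<beta> d b j i) + (d i - r) * nat (- \<beta> d b j i) + (if n < j then e i r j else 0))))"

definition lift_poly :: "nat \<Rightarrow> laurent" where
  "lift_poly i = (\<Sum>r\<in>{0..d i}. Poly_Mapping.single (lift_exp i r) (c i r))"

lemma lookup_lift_exp: "Poly_Mapping.lookup (lift_exp i r) j = (if j \<in> {1..m} then
    int (r * nat (\<beta> d b j i) + (d i - r) * nat (- \<beta> d b j i) + (if n < j then e i r j else 0)) else 0)"
  unfolding lift_exp_def by (rule lookup_sum_single) simp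

lemma ev_lift_poly:
  assumes i: "i \<in> {1..n}"
  shows "ev (lift_poly i) = exchange_poly m x \<rho> d b i"
proof -
  have "ev (lift_poly i) = (\<Sum>r\<in>{0..d i}. of_int (c i r) * mon (lift_exp i r))"
    by (simp add: lift_poly_def ev_sum ev_single)
  also have "\<dots> = exchange_poly m x \<rho> d b i"
    unfolding exchange_poly_def
  proof (rule sum.cong)
    fix r assume r: "r \<in> {0..d i}"
    let ?a = "\<lambda>j. r * nat (\<beta> d b j i) + (d i - r) * nat (- \<beta> d b j i)"
    have "mon (lift_exp i r) = (\<Prod>j\<in>{1..m}. x j ^ ?a j * (if n < j then x j ^ e i r j else 1))"
      unfolding mon_def lookup_lift_exp
      by (rule prod.cong) (simp_all add: power_add del: of_nat_add of_nat_mult)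
    also have "\<dots> = (\<Prod>j\<in>{1..m}. x j ^ ?a j) * (\<Prod>j\<in>{1..m}. if n < j then x j ^ e i r j else 1)"
      by (rule prod.distrib)
    also have "(\<Prod>j\<in>{1..m}. if n < j then x j ^ e i r j else 1) = (\<Prod>j\<in>{1..m} \<inter> {j. n < j}. x j ^ e i r j)"
      by (simp add: prod.inter_restrict)
    also have "{1..m} \<inter> {j. n < j} = {n+1..m}" by auto
    finally show "of_int (c i r) * mon (lift_exp i r) = \<rho> i r * (\<Prod>j\<in>{1..m}. x j ^ ?a j)"
      using rho[OF i, of r] r by (simp add: mult_ac)
  qed simp
  finally show ?thesis .
qed

lemma lift_poly_in_poly_ring: "lift_poly i \<in> poly_ring {1..m}"
  unfolding lift_poly_def
proof (rule subring_sum[OF is_subring_poly_ring])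
  fix r
  show "Poly_Mapping.single (lift_exp i r) (c i r) \<in> poly_ring {1..m}"
    by (auto simp: poly_ring_def laurent_ring_def homog_def deg_ge_def lookup_lift_exp)
qed

lemma lift_poly_nonzero:
  assumes "i \<in> {1..n}"
  shows "lift_poly i \<noteq> 0"
  using x'_nonzero ev_lift_poly[OF assms] assms ev_zero by (force simp: exchanged_var_def)

lemma lift_poly_homog:
  assumes "i \<in> {1..n}" "j \<in> {1..n}" "b i j = 0"
  shows "homog i 0 (lift_poly j)"
  unfolding lift_poly_def
proof (rule homog_sum)
  fix r
  have "\<beta> d b i j = 0" using beta_sign(4)[of i j] assms n_le_m by auto
  then show "homog i 0 (Poly_Mapping.single (lift_exp j r) (c j r))"
    using assms by (simp add: homog_def lookup_lift_exp)
qed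

text \<open>The \<open>r\<close>-th term has degree \<open>r * \<beta>\<^sub>i\<^sub>j\<close> in \<open>x\<^sub>i\<close>, so only the term with \<open>r = 0\<close> survives, and its
  coefficient is 1.\<close>
lemma lift_poly_degenerate:
  assumes "i \<in> {1..n}" "j \<in> {1..n}" "b i j > 0"
  shows "comp_deg i 0 (lift_poly j) = Poly_Mapping.single (lift_exp j 0) 1"
proof -
  have im: "i \<in> {1..m}" using assms n_le_m by auto
  then have \<beta>: "\<beta> d b i j > 0" using beta_sign(2)[of i j] assms by auto
  have "comp_deg i 0 (lift_poly j) =
      (\<Sum>r\<in>{0..d j}. if r = 0 then Poly_Mapping.single (lift_exp j r) (c j r) else 0)"
    unfolding lift_poly_def comp_deg_sum
  proof (rule sum.cong)
    fix r
    have "Poly_Mapping.lookup (lift_exp j r) i = 0 \<longleftrightarrow> r = 0"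
      using \<beta> im assms by (auto simp: lookup_lift_exp)
    then show "comp_deg i 0 (Poly_Mapping.single (lift_exp j r) (c j r)) =
        (if r = 0 then Poly_Mapping.single (lift_exp j r) (c j r) else 0)"
      using comp_deg_homog[OF homog_single[of i "lift_exp j r" "c j r"], of 0] by auto
  qed simp
  then show ?thesis using c0 assms by simp
qed

text \<open>The greatest common divisor of the two polynomials in \<open>\<int>[x\<^sub>1, \<dots>, x\<^sub>m]\<close> is a common factor in
  \<open>\<int>\<bbbP>[x\<^sub>1, \<dots>, x\<^sub>n]\<close>, hence a unit there by coprimality and a unit among the Laurent polynomials. What
  remains are cofactors that cancel against each other.\<close>
lemma lift_poly_cancels:
  assumes ij: "i \<in> {1..n}" "j \<in> {1..n}" "i \<noteq> j" and g: "g \<in> laurent_ring {1..m}"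
    and dvd: "lift_poly j dvd lift_poly i * g"
  shows "lift_poly j dvd g"
proof -
  let ?S = "poly_ring {1..m}" and ?R = "ZP_adjoin m n x (x ` {1..n})"
  have "gcd_subring ?S" by (rule gcd_subring_poly_ring) simp
  then obtain D p q where mem: "D \<in> ?S" "p \<in> ?S" "q \<in> ?S"
    and pq: "lift_poly j = D * p" "lift_poly i = D * q" and canc: "cancels_in ?S p q"
    using gcd_subringE lift_poly_in_poly_ring by metis
  have nz: "D \<noteq> 0" "p \<noteq> 0" using lift_poly_nonzero[OF ij(2)] pq by auto
  have "exchange_poly m x \<rho> d b j = ev D * ev p" "exchange_poly m x \<rho> d b i = ev D * ev q"
    using ev_lift_poly ij pq by (metis ev_mult)+
  moreover have "coprime_in ?R (exchange_poly m x \<rho> d b j) (exchange_poly m x \<rho> d b i)"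
    using coprime ij unfolding coprime_seed_def by metis
  moreover have "ev D \<in> ?R" "ev p \<in> ?R" "ev q \<in> ?R"
    using mem ev_poly_ring_in_ZP_adjoin by auto
  ultimately have "\<exists>u\<in>?R. ev D * u = 1"
    unfolding coprime_in_def by (metis (no_types))
  then obtain u where u: "u \<in> ?R" "ev D * u = 1" by blast
  have "x ` {1..n} \<subseteq> ev ` laurent_ring {1..m}"
  proof clarify
    fix k assume "k \<in> {1..n}"
    then have k: "k \<in> {1..m}" using n_le_m by auto
    then have "var k \<in> laurent_ring {1..m}" using var_in_poly_ring by (auto simp: poly_ring_def)
    then show "x k \<in> ev ` laurent_ring {1..m}" using ev_var[OF k] by (metis imageI)
  qed
  then obtain w where w: "w \<in> laurent_ring {1..m}" "u = ev w"
    using ZP_adjoin_laurent u(1) by blast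
  have "D * w = 1"
  proof (rule ev_inj)
    show "D * w \<in> laurent_ring {1..m}"
      using mem(1) w(1) subring_mult[OF is_subring_laurent_ring] by (auto simp: poly_ring_def)
    show "1 \<in> laurent_ring {1..m}" by (rule subring_one[OF is_subring_laurent_ring])
    show "ev (D * w) = ev 1" using u w by (simp add: ev_mult ev_one)
  qed
  then have D: "D dvd 1" by (metis dvd_triv_left)
  have "D * p dvd D * (q * g)" using dvd unfolding pq by (simp only: mult.assoc)
  then have "p dvd q * g" using nz by simp
  then have "p dvd g"
    using cancels_poly_ring_imp_laurent[OF _ canc mem(2,3) nz(2) g] by simp
  then have "D * p dvd 1 * g" by (intro mult_dvd_mono D)
  then show ?thesis using pq by simp
qed

lemma acyclic_exchange_lift:
  "acyclic_exchange {1..m} {1..n} lift_poly (\<lambda>j. lift_exp j 0) b"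
proof
  show "finite {1..m}" by simp
  show "{1..n} \<subseteq> {1..m}" using n_le_m by auto
  show "lift_poly j \<in> poly_ring {1..m}" for j by (rule lift_poly_in_poly_ring)
  show "lift_poly j \<noteq> 0" if "j \<in> {1..n}" for j using that by (rule lift_poly_nonzero)
  show "homog i 0 (lift_poly j)" if "i \<in> {1..n}" "j \<in> {1..n}" "b i j = 0" for i j
    using that by (rule lift_poly_homog)
  show "comp_deg i 0 (lift_poly j) = Poly_Mapping.single (lift_exp j 0) 1"
    if "i \<in> {1..n}" "j \<in> {1..n}" "b i j > 0" for i j
    using that by (rule lift_poly_degenerate)
  show "Poly_Mapping.lookup (lift_exp j 0) i = 0" if "i \<in> {1..n}" "j \<in> {1..n}" "b i j \<ge> 0" for i j
  proof -
    have "\<beta> d b i j \<ge> 0" using beta_sign(3)[of i j] that n_le_m by auto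
    then show ?thesis using that by (simp add: lookup_lift_exp)
  qed
  show "b i j > 0 \<longleftrightarrow> b j i < 0" if "i \<in> {1..n}" "j \<in> {1..n}" for i j
    using that by (rule b_antisym)
  show "acyclic {(i, j). i \<in> {1..n} \<and> j \<in> {1..n} \<and> b i j > 0}"
    using acyclic by (simp add: acyclic_seed_def)
  show "lift_poly j dvd g" if "i \<in> {1..n}" "j \<in> {1..n}" "i \<noteq> j" "g \<in> laurent_ring {1..m}"
    "lift_poly j dvd lift_poly i * g" for i j g
    using that by (rule lift_poly_cancels)
qed

interpretation E: acyclic_exchange "{1..m}" "{1..n}" lift_poly "\<lambda>j. lift_exp j 0" b
  by (rule acyclic_exchange_lift)

subsection \<open>The two bounds\<close>

lemma specialize_empty: "E.specialize {} j = lift_poly j"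
  unfolding E.specialize_def by (rule restrict_keys_id) simp

lemma ev_exchanged: "j \<in> {1..n} \<Longrightarrow> ev (E.exchanged {} j) = exchanged_var m x \<rho> d b j"
  using ev_var_inv[of j] n_le_m
  by (simp add: E.exchanged_def specialize_empty ev_mult ev_lift_poly exchanged_var_def)

lemma ev_lower_alg_lower_bound:
  assumes "y \<in> E.lower_alg {} {} {1..n}"
  shows "ev y \<in> lower_bound m n x \<rho> d b"
  using assms unfolding E.lower_alg_def
proof (induction rule: subring_gen.induct)
  case one
  show ?case unfolding ev_one lower_bound_def by (rule subring_one[OF is_subring_ZP_adjoin])
next
  case (diff u v)
  then show ?case unfolding ev_diff lower_bound_def by (intro subring_diff[OF is_subring_ZP_adjoin])
next
  case (mult u v)
  then show ?case unfolding ev_mult lower_bound_def by (intro subring_mult[OF is_subring_ZP_adjoin])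
next
  case (base y)
  then consider i where "y = var i" "i \<in> {n+1..m}" | i where "y = var_inv i" "i \<in> {n+1..m}"
    | i where "y = var i" "i \<in> {1..n}" | i where "y = E.exchanged {} i" "i \<in> {1..n}"
    by force
  then show ?case
  proof cases
    case 1
    then show ?thesis unfolding lower_bound_def using ev_var[of i] frozen_in_ZP_adjoin(1)[of i n m x]
      by auto
  next
    case 2
    then show ?thesis unfolding lower_bound_def using ev_var_inv[of i] frozen_in_ZP_adjoin(2)[of i n m x]
      by auto
  next
    case 3
    then have "ev y = x i" using ev_var[of i] n_le_m by auto
    moreover have "x i \<in> lower_bound m n x \<rho> d b"
      unfolding lower_bound_def using 3(2) by (intro ZP_adjoin_gen) blast
    ultimately show ?thesis by metis
  next
    case 4
    then show ?thesis unfolding lower_bound_def unfolding 4(1) ev_exchanged[OF 4(2)]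
      using 4(2) by (intro ZP_adjoin_gen) blast
  qed
qed

text \<open>A ring that contains the \<open>k\<close>-th ring of the upper bound. Its elements, which may have powers of
  \<open>P\<^sub>k\<close> in the denominator, are described by multiplying with \<open>P\<^sub>k ^ N\<close>.\<close>
definition exchange_ring :: "nat \<Rightarrow> 'a set" where
  "exchange_ring k = {z. \<exists>N w. w \<in> laurent_ring {1..m} \<and> div_cond k (lift_poly k) (int N) w \<and>
     ev (lift_poly k) ^ N * z = ev w}"

lemma exchange_ringI:
  assumes "w \<in> laurent_ring {1..m}" "div_cond k (lift_poly k) (int N) w"
    "ev (lift_poly k) ^ N * z = ev w"
  shows "z \<in> exchange_ring k"
  using assms by (auto simp: exchange_ring_def)

lemma lift_poly_laurent: "lift_poly k \<in> laurent_ring {1..m}"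
  using lift_poly_in_poly_ring by (simp add: poly_ring_def)

lemma lift_poly_homog_self: "k \<in> {1..n} \<Longrightarrow> homog k 0 (lift_poly k)"
  using lift_poly_homog[of k k] E.b_diag by simp

lemma is_subring_exchange_ring:
  assumes k: "k \<in> {1..n}"
  shows "is_subring (exchange_ring k)"
  unfolding is_subring_def
proof (intro conjI ballI)
  note L = is_subring_laurent_ring[of "{1..m}"]
  let ?P = "lift_poly k"
  show "1 \<in> exchange_ring k"
  proof (rule exchange_ringI[of 1 k 0])
    show "1 \<in> laurent_ring {1..m}" by (rule subring_one[OF L])
    show "div_cond k ?P (int 0) 1"
      using div_cond_deg_ge[OF homog_imp_deg_ge[OF homog_one]] by simp
  qed (simp add: ev_one)
  fix a a' assume "a \<in> exchange_ring k" "a' \<in> exchange_ring k"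
  then obtain N w N' w' where w: "w \<in> laurent_ring {1..m}" "div_cond k ?P (int N) w"
      "ev ?P ^ N * a = ev w"
    and w': "w' \<in> laurent_ring {1..m}" "div_cond k ?P (int N') w'" "ev ?P ^ N' * a' = ev w'"
    by (auto simp: exchange_ring_def)
  have pow: "div_cond k ?P (int l) (?P ^ l)" "?P ^ l \<in> laurent_ring {1..m}" for l
    using div_cond_homog[OF homog_power0[OF lift_poly_homog_self[OF k]], of ?P "int l" l]
      subring_power[OF L lift_poly_laurent] by auto
  show "a - a' \<in> exchange_ring k"
  proof (rule exchange_ringI)
    show "?P ^ N' * w - ?P ^ N * w' \<in> laurent_ring {1..m}"
      by (intro subring_diff[OF L] subring_mult[OF L] pow w w')
    show "div_cond k ?P (int (N + N')) (?P ^ N' * w - ?P ^ N * w')"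
      using div_cond_diff[OF div_cond_mult[OF pow(1)[of N'] w(2)]] div_cond_mult[OF pow(1)[of N] w'(2)]
      by (simp add: add.commute)
    show "ev ?P ^ (N + N') * (a - a') = ev (?P ^ N' * w - ?P ^ N * w')"
      by (simp add: ev_diff ev_mult ev_power power_add algebra_simps flip: w(3) w'(3))
  qed
  show "a * a' \<in> exchange_ring k"
  proof (rule exchange_ringI)
    show "w * w' \<in> laurent_ring {1..m}" by (intro subring_mult[OF L] w w')
    show "div_cond k ?P (int (N + N')) (w * w')"
      using div_cond_mult[OF w(2) w'(2)] by simp
    show "ev ?P ^ (N + N') * (a * a') = ev (w * w')"
      by (simp add: ev_mult power_add mult_ac flip: w(3) w'(3))
  qed
qed

text \<open>The inverse of \<open>x'\<^sub>k\<close> is \<open>x\<^sub>k / P\<^sub>k\<close>, which needs \<open>N = 1\<close>; all other generators are Laurent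
  polynomials that satisfy the condition with \<open>N = 0\<close>.\<close>
lemma upper_bound_subset_exchange_ring:
  assumes k: "k \<in> {1..n}"
  shows "ZP_adjoin m n x ({exchanged_var m x \<rho> d b k, inverse (exchanged_var m x \<rho> d b k)} \<union>
    (\<Union>i\<in>{1..n} - {k}. {x i, inverse (x i)})) \<subseteq> exchange_ring k"
proof (rule ZP_adjoin_subset[OF is_subring_exchange_ring[OF k]])
  let ?P = "lift_poly k"
  have laurent: "ev w \<in> exchange_ring k" if "w \<in> laurent_ring {1..m}" "homog k 0 w" for w
    using that by (intro exchange_ringI[of w k 0]) (auto intro: div_cond_deg_ge homog_imp_deg_ge)
  have km: "k \<in> {1..m}" using k n_le_m by auto
  show "coeff_group m n x \<subseteq> exchange_ring k"
  proof
    fix z assume "z \<in> coeff_group m n x"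
    then obtain e where z: "z = ev (Poly_Mapping.single e 1)"
      "\<forall>i. i \<notin> {n+1..m} \<longrightarrow> Poly_Mapping.lookup e i = 0"
      by (rule coeff_group_ev)
    have "Poly_Mapping.single e 1 \<in> laurent_ring {1..m}" "homog k 0 (Poly_Mapping.single e 1)"
      using z(2) k by (auto simp: laurent_ring_def homog_def)
    then show "z \<in> exchange_ring k" unfolding z(1) by (rule laurent)
  qed
  have "x i \<in> exchange_ring k" "inverse (x i) \<in> exchange_ring k" if i: "i \<in> {1..n} - {k}" for i
  proof -
    have im: "i \<in> {1..m}" using i n_le_m by auto
    have "homog k 0 (var i)" "homog k 0 (var_inv i)"
      using homog_var[of k i] homog_var_inv[of k i] i by auto
    then show "x i \<in> exchange_ring k" "inverse (x i) \<in> exchange_ring k"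
      using laurent[OF E.var_in_laurent_ring[OF im]] laurent[OF E.var_inv_in_laurent_ring[OF im]]
        ev_var[OF im] ev_var_inv[OF im] by auto
  qed
  moreover have "exchanged_var m x \<rho> d b k \<in> exchange_ring k"
  proof (rule exchange_ringI[of "E.exchanged {} k" k 0])
    show "E.exchanged {} k \<in> laurent_ring {1..m}"
      unfolding E.exchanged_def specialize_empty
      by (intro subring_mult[OF is_subring_laurent_ring] E.var_inv_in_laurent_ring km lift_poly_laurent)
    have "?P dvd E.exchanged {} k" by (simp add: E.exchanged_def specialize_empty)
    then show "div_cond k ?P (int 0) (E.exchanged {} k)"
      using div_cond_homog[OF E.homog_exchanged[OF k]] by simp
    show "ev ?P ^ 0 * exchanged_var m x \<rho> d b k = ev (E.exchanged {} k)"
      using ev_exchanged[OF k] by simp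
  qed
  moreover have "inverse (exchanged_var m x \<rho> d b k) \<in> exchange_ring k"
  proof (rule exchange_ringI[of "var k" k 1])
    show "var k \<in> laurent_ring {1..m}" by (rule E.var_in_laurent_ring[OF km])
    show "div_cond k ?P (int 1) (var k)"
      using div_cond_homog[OF homog_var[of k k], of ?P 1] by simp
    have "exchange_poly m x \<rho> d b k \<noteq> 0"
      using x'_nonzero k by (auto simp: exchanged_var_def)
    then show "ev ?P ^ 1 * inverse (exchanged_var m x \<rho> d b k) = ev (var k)"
      using x_nonzero[OF km] ev_var[OF km] ev_lift_poly[OF k] by (simp add: exchanged_var_def field_simps)
  qed
  ultimately show "{exchanged_var m x \<rho> d b k, inverse (exchanged_var m x \<rho> d b k)} \<union>
    (\<Union>i\<in>{1..n} - {k}. {x i, inverse (x i)}) \<subseteq> exchange_ring k" by blast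
qed

lemma exchange_ring_div_cond:
  assumes k: "k \<in> {1..n}" and y: "y \<in> laurent_ring {1..m}" "ev y \<in> exchange_ring k"
  shows "div_cond k (lift_poly k) 0 y"
proof -
  let ?P = "lift_poly k"
  obtain N w where w: "w \<in> laurent_ring {1..m}" "div_cond k ?P (int N) w" "ev ?P ^ N * ev y = ev w"
    using y(2) by (auto simp: exchange_ring_def)
  have "?P ^ N * y = w"
  proof (rule ev_inj[OF _ w(1)])
    show "?P ^ N * y \<in> laurent_ring {1..m}"
      by (intro subring_mult[OF is_subring_laurent_ring] subring_power[OF is_subring_laurent_ring]
          lift_poly_laurent y)
    show "ev (?P ^ N * y) = ev w" using w(3) by (simp add: ev_mult ev_power)
  qed
  then have comp: "comp_deg k a w = ?P ^ N * comp_deg k a y" for a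
    using comp_deg_mult_homog[OF homog_power0[OF lift_poly_homog_self[OF k]], of a N y] by simp
  show ?thesis
    unfolding div_cond_def
  proof
    fix a
    show "?P ^ nat (0 - a) dvd comp_deg k a y"
    proof (cases "a < 0")
      case True
      then have "nat (int N - a) = N + nat (0 - a)" by simp
      then have "?P ^ N * ?P ^ nat (0 - a) dvd ?P ^ N * comp_deg k a y"
        using w(2) unfolding div_cond_def comp by (metis power_add)
      then show ?thesis using lift_poly_nonzero[OF k] by simp
    qed simp
  qed
qed

lemma upper_bound_subset_lower_bound: "upper_bound m n x \<rho> d b \<subseteq> lower_bound m n x \<rho> d b"
proof
  fix z assume z: "z \<in> upper_bound m n x \<rho> d b"
  have "(\<Union>i\<in>{1..n}. {x i, inverse (x i)}) \<subseteq> ev ` laurent_ring {1..m}"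
  proof -
    have "x i \<in> ev ` laurent_ring {1..m}" "inverse (x i) \<in> ev ` laurent_ring {1..m}"
      if "i \<in> {1..n}" for i
    proof -
      have im: "i \<in> {1..m}" using that n_le_m by auto
      show "x i \<in> ev ` laurent_ring {1..m}" "inverse (x i) \<in> ev ` laurent_ring {1..m}"
        using E.var_in_laurent_ring[OF im] E.var_inv_in_laurent_ring[OF im]
          ev_var[OF im] ev_var_inv[OF im] by (metis imageI)+
    qed
    then show ?thesis by auto
  qed
  from ZP_adjoin_laurent[OF this] have "upper_bound m n x \<rho> d b \<subseteq> ev ` laurent_ring {1..m}"
    unfolding upper_bound_def by (rule order_trans[OF Int_lower1])
  then have "z \<in> ev ` laurent_ring {1..m}" using z by (rule subsetD)
  then obtain y where y: "y \<in> laurent_ring {1..m}" "z = ev y" by auto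
  have "div_cond k (lift_poly k) 0 y" if k: "k \<in> {1..n}" for k
  proof (rule exchange_ring_div_cond[OF k y(1)])
    show "ev y \<in> exchange_ring k"
      using z k upper_bound_subset_exchange_ring[OF k] unfolding upper_bound_def y(2) by blast
  qed
  then have "y \<in> E.upper_alg {} {} {1..n}"
    using y(1) unfolding E.upper_alg_def specialize_empty by simp
  then have "y \<in> E.lower_alg {} {} {1..n}"
    by (intro E.upper_alg_subset_lower_alg) (simp, unfold E.stage_def, simp)
  then show "z \<in> lower_bound m n x \<rho> d b" using ev_lower_alg_lower_bound y by simp
qed

text \<open>\<open>P\<^sub>i\<close> does not involve \<open>x\<^sub>i\<close>, because the principal part has zero diagonal.\<close>
lemma exchange_poly_in_ZP_adjoin:
  assumes i: "i \<in> {1..n}" and x: "\<And>j. j \<in> {1..n} \<Longrightarrow> j \<noteq> i \<Longrightarrow> x j \<in> ZP_adjoin m n x S"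
  shows "exchange_poly m x \<rho> d b i \<in> ZP_adjoin m n x S"
  unfolding exchange_poly_def
proof (rule subring_sum[OF is_subring_ZP_adjoin])
  note R = is_subring_ZP_adjoin[of m n x S]
  fix r assume r: "r \<in> {0..d i}"
  have "\<rho> i r \<in> ZP_adjoin m n x S"
    unfolding rho[OF i, of r] using r rho[OF i, of r]
    by (auto intro!: subring_mult[OF R] subring_of_int[OF R] subring_prod[OF R]
        subring_power[OF R] frozen_in_ZP_adjoin)
  moreover have "x j ^ (r * nat (\<beta> d b j i) + (d i - r) * nat (- \<beta> d b j i)) \<in> ZP_adjoin m n x S"
    if j: "j \<in> {1..m}" for j
  proof (cases "j = i")
    case True
    have "\<beta> d b i i = 0" using beta_sign(4)[of i i] i n_le_m E.b_diag by auto
    then show ?thesis using True subring_one[OF R] by simp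
  next
    case False
    have "x j \<in> ZP_adjoin m n x S"
      using x[of j] frozen_in_ZP_adjoin[of j n m x] False j by (cases "j \<le> n") auto
    then show ?thesis by (rule subring_power[OF R])
  qed
  ultimately show "\<rho> i r * (\<Prod>j\<in>{1..m}. x j ^ (r * nat (\<beta> d b j i) + (d i - r) * nat (- \<beta> d b j i)))
      \<in> ZP_adjoin m n x S"
    by (intro subring_mult[OF R] subring_prod[OF R])
qed

lemma lower_bound_subset_upper_bound: "lower_bound m n x \<rho> d b \<subseteq> upper_bound m n x \<rho> d b"
proof -
  let ?x' = "exchanged_var m x \<rho> d b"
  let ?L = "\<Union>i\<in>{1..n}. {x i, inverse (x i)}"
  let ?U = "\<lambda>k. {?x' k, inverse (?x' k)} \<union> (\<Union>i\<in>{1..n} - {k}. {x i, inverse (x i)})"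
  have lower: "lower_bound m n x \<rho> d b \<subseteq> ZP_adjoin m n x S"
    if "\<And>i. i \<in> {1..n} \<Longrightarrow> x i \<in> ZP_adjoin m n x S \<and> ?x' i \<in> ZP_adjoin m n x S" for S
    unfolding lower_bound_def
    by (rule ZP_adjoin_subset[OF is_subring_ZP_adjoin coeff_group_in_ZP_adjoin]) (use that in auto)
  have "lower_bound m n x \<rho> d b \<subseteq> ZP_adjoin m n x ?L"
  proof (rule lower, rule conjI)
    fix i assume i: "i \<in> {1..n}"
    note R = is_subring_ZP_adjoin[of m n x ?L]
    have x: "x j \<in> ZP_adjoin m n x ?L" if "j \<in> {1..n}" for j
      using that by (intro ZP_adjoin_gen) blast
    show "x i \<in> ZP_adjoin m n x ?L" by (rule x[OF i])
    have "inverse (x i) \<in> ZP_adjoin m n x ?L"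
      using i by (intro ZP_adjoin_gen) blast
    then show "?x' i \<in> ZP_adjoin m n x ?L"
      unfolding exchanged_var_def by (intro subring_mult[OF R] exchange_poly_in_ZP_adjoin i x)
  qed
  moreover have "lower_bound m n x \<rho> d b \<subseteq> ZP_adjoin m n x (?U k)" if k: "k \<in> {1..n}" for k
  proof (rule lower, rule conjI)
    fix i assume i: "i \<in> {1..n}"
    note R = is_subring_ZP_adjoin[of m n x "?U k"]
    have other: "x j \<in> ZP_adjoin m n x (?U k)" "inverse (x j) \<in> ZP_adjoin m n x (?U k)"
      if "j \<in> {1..n}" "j \<noteq> k" for j
      using that by (intro ZP_adjoin_gen; blast)+
    have x'k: "?x' k \<in> ZP_adjoin m n x (?U k)" "inverse (?x' k) \<in> ZP_adjoin m n x (?U k)"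
      by (intro ZP_adjoin_gen; blast)+
    \<comment> \<open>the \<open>k\<close>-th ring does not have \<open>x\<^sub>k\<close> among its generators, but contains it\<close>
    have "x k = inverse (?x' k) * exchange_poly m x \<rho> d b k"
    proof -
      have "x k \<noteq> 0" "exchange_poly m x \<rho> d b k \<noteq> 0"
        using x_nonzero[of k] k n_le_m x'_nonzero by (auto simp: exchanged_var_def)
      then show ?thesis by (simp add: exchanged_var_def field_simps)
    qed
    moreover have "inverse (?x' k) * exchange_poly m x \<rho> d b k \<in> ZP_adjoin m n x (?U k)"
      by (intro subring_mult[OF R] x'k exchange_poly_in_ZP_adjoin k other)
    ultimately have "x k \<in> ZP_adjoin m n x (?U k)" by metis
    then have x: "x j \<in> ZP_adjoin m n x (?U k)" if "j \<in> {1..n}" for j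
      using other(1)[OF that] by (cases "j = k") auto
    show "x i \<in> ZP_adjoin m n x (?U k)" by (rule x[OF i])
    show "?x' i \<in> ZP_adjoin m n x (?U k)"
    proof (cases "i = k")
      case True
      then show ?thesis using x'k by simp
    next
      case False
      then have "inverse (x i) * exchange_poly m x \<rho> d b i \<in> ZP_adjoin m n x (?U k)"
        by (intro subring_mult[OF R] other(2) exchange_poly_in_ZP_adjoin i x)
      then show ?thesis by (simp only: exchanged_var_def)
    qed
  qed
  ultimately show ?thesis unfolding upper_bound_def by blast
qed

end

end

theorem theorem3p10:
  fixes m n :: nat
    and x :: "nat \<Rightarrow> 'a::field_char_0"
    and \<rho> :: "nat \<Rightarrow> nat \<Rightarrow> 'a"
    and d :: "nat \<Rightarrow> nat"
    and b :: "nat \<Rightarrow> nat \<Rightarrow> int"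
  assumes "generalized_seed m n x \<rho> d b"
    and "\<forall>k\<in>{1..n}. exchanged_var m x \<rho> d b k \<noteq> 0"
    and "coprime_seed m n x \<rho> d b"
    and "acyclic_seed n b"
  shows "lower_bound m n x \<rho> d b = upper_bound m n x \<rho> d b"
proof -
  interpret generalized_seed m n x \<rho> d b by (rule assms(1))
  obtain c :: "nat \<Rightarrow> nat \<Rightarrow> int" and e :: "nat \<Rightarrow> nat \<Rightarrow> nat \<Rightarrow> nat"
    where ce: "\<forall>i\<in>{1..n}. \<forall>r\<le>d i.
     \<rho> i r = of_int (c i r) * (\<Prod>k\<in>{n+1..m}. x k ^ e i r k) \<and>
     (r = 0 \<longrightarrow> c i r = (1::int) \<and> e i r = (\<lambda>_. 0::nat))"
    using rho_data by blast
  have rho: "\<And>i r. i \<in> {1..n} \<Longrightarrow> r \<le> d i \<Longrightarrow>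
      \<rho> i r = of_int (c i r) * (\<Prod>k\<in>{n+1..m}. x k ^ e i r k)"
    and c0: "\<And>i. i \<in> {1..n} \<Longrightarrow> c i 0 = 1" and e0: "\<And>i. i \<in> {1..n} \<Longrightarrow> e i 0 = (\<lambda>_. 0)"
    using ce by blast+
  show ?thesis
  proof (rule subset_antisym)
    show "lower_bound m n x \<rho> d b \<subseteq> upper_bound m n x \<rho> d b"
      by (rule lower_bound_subset_upper_bound[OF rho c0 e0 assms(2-4)])
    show "upper_bound m n x \<rho> d b \<subseteq> lower_bound m n x \<rho> d b"
      by (rule upper_bound_subset_lower_bound[OF rho c0 e0 assms(2-4)])
  qed
qed

end
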